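(* Let $\phi:\mathbb{R}^2\to\mathbb{R}$ be a nonnegative, twice continuously differentiable, strictly convex function whose Hessian $H(\phi)$ satisfies one of the following conditions: (i) $H(\phi)(y_0)=0$ for some $y_0\in\mathbb{R}^2$, or (ii) there exists a sequence $\{y_n\}\subset\mathbb{R}^2$ with $|y_n|\to\infty$ such that $H(\phi)(y_n)\to 0$ as $n\to\infty$. Let $\psi=|\cdot|^2+\phi$ and let $\sigma$ denote the projection measure on the surface $\Sigma_\phi=\{(y,\psi(y)):y\in\mathbb{R}^2\}\subset\mathbb{R}^3$. Then the inequality $$\|f\sigma\ast f\sigma\|_{L^2(\mathbb{R}^3)}\leq \mathcal R_\phi^2\,\|f\|_{L^2(\mathbb{R}^2)}^2\qquad(\ast)$$ holds for every $f\in L^2(\mathbb{R}^2)$, where the optimal (smallest possible) constant is $$\mathcal R_\phi=\Big(\frac{\pi}{2}\Big)^{1/4}.$$ The sequence $\{f_n/\|f_n\|_{L^2(\mathbb{R}^2)}\}$ defined via $$f_n(y):=\begin{cases} e^{-n(\psi(y)-\psi(y_0)-\langle\nabla\psi(y_0),y-y_0\rangle)}, & \text{in case (i)},\\ e^{-a_n(\psi(y)-\psi(y_n)-\langle\nabla\psi(y_n),y-y_n\rangle)}, & \text{in case (ii)},\end{cases}$$ where in case (ii) $\{a_n\}$ is an appropriately chosen sequence of positive numbers (i.e. such a sequence exists), is extremizing for inequality $(\ast)$. Moreover, extremizers for inequality $(\ast)$ do not exist.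
   Context: The projection measure $\sigma$ on $\Sigma_\phi$ is defined by $\int_{\mathbb{R}^{3}} g\,d\sigma=\int_{\mathbb{R}^2} g(y,|y|^2+\phi(y))\,dy$ for every Schwartz function $g$ (written $\sigma(y,t)=\delta(t-|y|^2-\phi(y))\,dy\,dt$). For $f$ on $\mathbb{R}^2$, $f\sigma$ denotes the measure $\int g\,d(f\sigma)=\int_{\mathbb{R}^2} g(y,|y|^2+\phi(y))f(y)\,dy$; the convolution $f\sigma\ast f\sigma$ is identified with its density with respect to Lebesgue measure on $\mathbb{R}^3$. The optimal constant is $\mathcal R_\phi:=\sup_{0\neq f\in L^2(\mathbb{R}^2)}\|f\sigma\ast f\sigma\|_{L^2(\mathbb{R}^3)}^{1/2}/\|f\|_{L^2(\mathbb{R}^2)}$. An extremizing sequence for $(\ast)$ is a sequence $\{f_n\}\subset L^2(\mathbb{R}^2)$ with $\|f_n\|_{L^2}\leq1$ and $\|f_n\sigma\ast f_n\sigma\|_{L^2(\mathbb{R}^3)}\to\mathcal R_\phi^2$ as $n\to\infty$. An extremizer for $(\ast)$ is a nonzero $f\in L^2(\mathbb{R}^2)$ with $\|f\sigma\ast f\sigma\|_{L^2(\mathbb{R}^3)}=\mathcal R_\phi^2\|f\|_{L^2(\mathbb{R}^2)}^2$. *)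

theory Defs
  imports "HOL-Analysis.Analysis"
begin

definition gradient :: "(real^2 \<Rightarrow> real) \<Rightarrow> real^2 \<Rightarrow> real^2" where
  "gradient u y = (THE D. GDERIV u y :> D)"

definition hessian :: "(real^2 \<Rightarrow> real) \<Rightarrow> real^2 \<Rightarrow> real^2^2" where
  "hessian u y = jacobian (gradient u) (at y)"

definition C2 :: "(real^2 \<Rightarrow> real) \<Rightarrow> bool" where
  "C2 u \<longleftrightarrow> (\<forall>y. u differentiable (at y)) \<and> (\<forall>y. gradient u differentiable (at y))
     \<and> continuous_on UNIV (hessian u)"

definition strictly_convex :: "('a::real_vector \<Rightarrow> real) \<Rightarrow> bool" where
  "strictly_convex u \<longleftrightarrow> (\<forall>x y t. x \<noteq> y \<longrightarrow> 0 < t \<longrightarrow> t < 1 \<longrightarrow>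
     u ((1 - t) *\<^sub>R x + t *\<^sub>R y) < (1 - t) * u x + t * u y)"

text \<open>Elements of \<open>L\<^sup>2\<close> are represented by complex-valued Borel functions.\<close>

definition in_L2 :: "('a::euclidean_space \<Rightarrow> complex) \<Rightarrow> bool" where
  "in_L2 f \<longleftrightarrow> f \<in> borel_measurable lborel \<and> integrable lborel (\<lambda>x. (cmod (f x))\<^sup>2)"

text \<open>Only meaningful for functions satisfying \<^const>\<open>in_L2\<close>.\<close>

definition L2_norm :: "('a::euclidean_space \<Rightarrow> complex) \<Rightarrow> real" where
  "L2_norm f = sqrt (LINT x|lborel. (cmod (f x))\<^sup>2)"

definition psi :: "(real^2 \<Rightarrow> real) \<Rightarrow> real^2 \<Rightarrow> real" where
  "psi \<phi> y = (norm y)\<^sup>2 + \<phi> y"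

text \<open>\<open>\<real>\<^sup>3\<close> is rendered as \<open>\<real>\<^sup>2 \<times> \<real>\<close>, with product Lebesgue measure.\<close>

definition proj_measure :: "(real^2 \<Rightarrow> real) \<Rightarrow> ((real^2) \<times> real) measure" where
  "proj_measure \<phi> = distr lborel borel (\<lambda>y. (y, psi \<phi> y))"

text \<open>The integral of \<open>g\<close> against \<open>f\<sigma>\<close>; since \<open>\<sigma>\<close> lives on the graph of \<open>\<psi>\<close>,
  \<open>f\<close> is evaluated at the first component.\<close>

definition fsigma_integral ::
  "(real^2 \<Rightarrow> real) \<Rightarrow> (real^2 \<Rightarrow> complex) \<Rightarrow> ((real^2) \<times> real \<Rightarrow> complex) \<Rightarrow> complex" where
  "fsigma_integral \<phi> f g = (LINT p|proj_measure \<phi>. g p * f (fst p))"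

text \<open>For \<open>f\<close> in \<open>L\<^sup>2\<close>, \<open>f\<sigma> * f\<sigma>\<close> is in general only a locally finite complex measure, so
  it is evaluated on bounded Borel sets: \<open>(\<mu> * \<nu>)(A) = \<integral>\<integral> 1\<^sub>A(p + q) d\<mu>(p) d\<nu>(q)\<close>.\<close>

definition fsigma_conv ::
  "(real^2 \<Rightarrow> real) \<Rightarrow> (real^2 \<Rightarrow> complex) \<Rightarrow> ((real^2) \<times> real) set \<Rightarrow> complex" where
  "fsigma_conv \<phi> f A =
     fsigma_integral \<phi> f (\<lambda>q. fsigma_integral \<phi> f (\<lambda>p. indicator A (p + q)))"

definition is_conv_density ::
  "(real^2 \<Rightarrow> real) \<Rightarrow> (real^2 \<Rightarrow> complex) \<Rightarrow> ((real^2) \<times> real \<Rightarrow> complex) \<Rightarrow> bool" where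
  "is_conv_density \<phi> f F \<longleftrightarrow> F \<in> borel_measurable lborel \<and>
     (\<forall>A\<in>sets borel. bounded A \<longrightarrow>
        set_integrable lborel A F \<and> (LINT p:A|lborel. F p) = fsigma_conv \<phi> f A)"

text \<open>The density is unique up to null sets. The norm of the convolution is infinite
  if there is no density or if the density is not in \<open>L\<^sup>2\<close>.\<close>

definition conv_density ::
  "(real^2 \<Rightarrow> real) \<Rightarrow> (real^2 \<Rightarrow> complex) \<Rightarrow> (real^2) \<times> real \<Rightarrow> complex" where
  "conv_density \<phi> f = (SOME F. is_conv_density \<phi> f F)"

definition conv_norm :: "(real^2 \<Rightarrow> real) \<Rightarrow> (real^2 \<Rightarrow> complex) \<Rightarrow> ereal" where
  "conv_norm \<phi> f =
     (if (\<exists>F. is_conv_density \<phi> f F) \<and> in_L2 (conv_density \<phi> f)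
      then ereal (L2_norm (conv_density \<phi> f)) else \<infinity>)"

definition ereal_sqrt :: "ereal \<Rightarrow> ereal" where
  "ereal_sqrt x = (if x = \<infinity> then \<infinity> else ereal (sqrt (real_of_ereal x)))"

definition nonzero_L2 :: "(real^2 \<Rightarrow> complex) \<Rightarrow> bool" where
  "nonzero_L2 f \<longleftrightarrow> in_L2 f \<and> \<not> (AE x in lborel. f x = 0)"

definition opt_const :: "(real^2 \<Rightarrow> real) \<Rightarrow> ereal" where
  "opt_const \<phi> = (SUP f\<in>{f. nonzero_L2 f}. ereal_sqrt (conv_norm \<phi> f) / ereal (L2_norm f))"

definition extremizing_seq :: "(real^2 \<Rightarrow> real) \<Rightarrow> (nat \<Rightarrow> real^2 \<Rightarrow> complex) \<Rightarrow> bool" where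
  "extremizing_seq \<phi> f \<longleftrightarrow> (\<forall>n. in_L2 (f n) \<and> L2_norm (f n) \<le> 1)
     \<and> (\<lambda>n. conv_norm \<phi> (f n)) \<longlonglongrightarrow> (opt_const \<phi>)\<^sup>2"

definition extremizer :: "(real^2 \<Rightarrow> real) \<Rightarrow> (real^2 \<Rightarrow> complex) \<Rightarrow> bool" where
  "extremizer \<phi> f \<longleftrightarrow> nonzero_L2 f
     \<and> conv_norm \<phi> f = (opt_const \<phi>)\<^sup>2 * ereal ((L2_norm f)\<^sup>2)"

definition tangent_exp :: "(real^2 \<Rightarrow> real) \<Rightarrow> real \<Rightarrow> real^2 \<Rightarrow> real^2 \<Rightarrow> complex" where
  "tangent_exp \<phi> a z y =
     of_real (exp (- a * (psi \<phi> y - psi \<phi> z - gradient (psi \<phi>) z \<bullet> (y - z))))"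

definition L2_normalize :: "(real^2 \<Rightarrow> complex) \<Rightarrow> real^2 \<Rightarrow> complex" where
  "L2_normalize f = (\<lambda>y. f y / of_real (L2_norm f))"

definition hessian_vanishes_at :: "(real^2 \<Rightarrow> real) \<Rightarrow> real^2 \<Rightarrow> bool" where
  "hessian_vanishes_at \<phi> y0 \<longleftrightarrow> hessian \<phi> y0 = 0"

definition hessian_vanishes_along :: "(real^2 \<Rightarrow> real) \<Rightarrow> (nat \<Rightarrow> real^2) \<Rightarrow> bool" where
  "hessian_vanishes_along \<phi> y \<longleftrightarrow> filterlim (\<lambda>n. norm (y n)) at_top sequentially
     \<and> (\<lambda>n. hessian \<phi> (y n)) \<longlonglongrightarrow> 0"

end

theory Submission
  imports Defs "HOL-Probability.Distributions"
begin

text \<open>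
  Write \<open>S(x, y) = (x + y, \<psi>(x) + \<psi>(y))\<close>, so that \<open>f\<sigma> * f\<sigma>\<close> is the push-forward under \<open>S\<close> of
  \<open>u(x, y) = f(x) f(y)\<close>. With the weight
  \<open>w(x, y) = 1 + \<langle>\<nabla>\<phi>(x) - \<nabla>\<phi>(y), x - y\<rangle> / (2 |x - y|\<^sup>2)\<close>, which is the ratio of the radial derivatives of
  \<open>\<psi>(\<eta> + z) + \<psi>(\<eta> - z)\<close> and of \<open>2 |z|\<^sup>2\<close>, one has \<open>\<integral> G(S) w \<le> (\<pi>/2) \<integral> G\<close> for all \<open>G \<ge> 0\<close>.
  Duality and the Cauchy--Schwarz inequality give
  \<open>\<parallel>f\<sigma> * f\<sigma>\<parallel>\<^sup>2 \<le> (\<pi>/2) \<integral> |u|\<^sup>2 / w\<close>. Strict convexity makes \<open>w > 1\<close> off the diagonal, so the right-hand side is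
  strictly smaller than \<open>(\<pi>/2) \<parallel>f\<parallel>\<^sup>4\<close> unless \<open>f = 0\<close>, and extremizers do not exist.

  For a tangential exponential \<open>f\<close> at \<open>z\<close> with parameter \<open>a\<close>, \<open>u\<close> is a function \<open>E\<close> of \<open>S\<close>. Testing the density against
  \<open>E\<close>, cut off to a solid paraboloid that contains the range of \<open>S\<close>, gives
  \<open>\<parallel>f\<sigma> * f\<sigma>\<parallel> \<ge> a \<parallel>f\<parallel>\<^sup>4 / sqrt(\<pi>/2)\<close>, and \<open>a \<parallel>f\<parallel>\<^sup>2\<close> is close to
  \<open>\<pi>/2\<close> for large \<open>a\<close> when the Hessian of \<open>\<phi>\<close> is small at \<open>z\<close>.
\<close>

section \<open>Gradients of convex functions\<close>

text \<open>The definite description in \<open>gradient\<close> denotes: the derivative is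
  represented by the vector \<open>g\<close> assembled from its values on a basis, and two
  representing vectors have the same inner product with every \<open>h\<close>, so they
  agree.\<close>

lemma has_gderiv_gradient:
  assumes "u differentiable (at y)"
  shows "GDERIV u y :> gradient u y"
proof -
  obtain D where D: "(u has_derivative D) (at y)"
    using assms unfolding differentiable_def by blast
  then have lin: "linear D" by (rule has_derivative_linear)
  define g where "g = (\<Sum>b\<in>Basis. D b *\<^sub>R b)"
  have "D h = h \<bullet> g" for h
  proof -
    have "D h = D (\<Sum>b\<in>Basis. (h \<bullet> b) *\<^sub>R b)" by (simp add: euclidean_representation)
    also have "\<dots> = (\<Sum>b\<in>Basis. (h \<bullet> b) * D b)"
      by (simp add: linear_sum[OF lin] linear_scale[OF lin])
    also have "\<dots> = h \<bullet> g" by (simp add: g_def inner_sum_right mult.commute)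
    finally show ?thesis .
  qed
  then have g: "GDERIV u y :> g" using D unfolding gderiv_def by (metis ext)
  have "g' = g" if "GDERIV u y :> g'" for g'
  proof -
    have "(\<lambda>h. h \<bullet> g') = (\<lambda>h. h \<bullet> g)"
      using that g unfolding gderiv_def by (rule has_derivative_unique)
    then show ?thesis by (metis inner_eq_zero_iff inner_diff_right right_minus_eq)
  qed
  with g have "gradient u y = g" unfolding gradient_def by (rule the_equality)
  with g show ?thesis by simp
qed

lemma gradient_eqI:
  assumes "GDERIV u y :> g"
  shows "gradient u y = g"
proof -
  have "u differentiable (at y)" using assms unfolding gderiv_def differentiable_def by blast
  from has_gderiv_gradient[OF this] assms
  have "(\<lambda>h. h \<bullet> gradient u y) = (\<lambda>h. h \<bullet> g)"
    unfolding gderiv_def by (rule has_derivative_unique)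
  then show ?thesis by (metis inner_eq_zero_iff inner_diff_right right_minus_eq)
qed

lemma C2_gderiv: "C2 u \<Longrightarrow> GDERIV u y :> gradient u y"
  by (simp add: C2_def has_gderiv_gradient)

lemma C2_continuous: "C2 u \<Longrightarrow> continuous_on UNIV u"
  by (simp add: C2_def continuous_at_imp_continuous_on differentiable_imp_continuous_within)

lemma C2_continuous_gradient: "C2 u \<Longrightarrow> continuous_on UNIV (gradient u)"
  by (simp add: C2_def continuous_at_imp_continuous_on differentiable_imp_continuous_within)

lemma gderiv_norm_square: "GDERIV (\<lambda>y. (norm y)\<^sup>2) y :> 2 *\<^sub>R y"
  unfolding gderiv_def power2_norm_eq_inner
  by (auto intro!: derivative_eq_intros simp: inner_commute)

lemma gradient_psi:
  assumes "C2 \<phi>"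
  shows "gradient (psi \<phi>) y = 2 *\<^sub>R y + gradient \<phi> y"
  using GDERIV_add[OF gderiv_norm_square C2_gderiv[OF assms]]
  by (intro gradient_eqI) (simp add: psi_def[abs_def])

lemma gderiv_along_line:
  assumes "GDERIV u (x + s *\<^sub>R e) :> g"
  shows "((\<lambda>s. u (x + s *\<^sub>R e)) has_real_derivative e \<bullet> g) (at s)"
proof -
  have 1: "((\<lambda>s. x + s *\<^sub>R e) has_derivative (\<lambda>h. h *\<^sub>R e)) (at s)"
    by (auto intro!: derivative_eq_intros)
  have "((\<lambda>s. u (x + s *\<^sub>R e)) has_derivative (\<lambda>h. (h *\<^sub>R e) \<bullet> g)) (at s)"
    using has_derivative_compose[OF 1] assms unfolding gderiv_def by blast
  then show ?thesis
    by (simp add: has_field_derivative_def mult_commute_abs)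
qed

text \<open>Convexity bounds the difference quotients on the segment towards \<open>w\<close> by
  \<open>u w - u x\<close>; letting the step tend to 0 from the right gives the weak inequality.
  Strictness is recovered from the midpoint.\<close>

lemma strictly_convex_above_tangent:
  fixes u :: "'a::real_inner \<Rightarrow> real"
  assumes conv: "strictly_convex u" and g: "GDERIV u x :> g" and "x \<noteq> y"
  shows "u x + g \<bullet> (y - x) < u y"
proof -
  have weak: "u x + g \<bullet> (w - x) \<le> u w" if "w \<noteq> x" for w
  proof -
    have "((\<lambda>s. u (x + s *\<^sub>R (w - x))) has_real_derivative (w - x) \<bullet> g) (at 0)"
      by (rule gderiv_along_line) (use g in simp)
    then have "((\<lambda>h. (u (x + h *\<^sub>R (w - x)) - u x) / h) \<longlongrightarrow> (w - x) \<bullet> g) (at 0)"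
      by (simp add: DERIV_def)
    then have lim: "((\<lambda>h. (u (x + h *\<^sub>R (w - x)) - u x) / h) \<longlongrightarrow> (w - x) \<bullet> g) (at_right 0)"
      by (rule filterlim_mono) (auto simp: at_le)
    have "eventually (\<lambda>h. h \<in> {0<..<1::real}) (at_right 0)"
      by (rule eventually_at_right_real) simp
    then have "eventually (\<lambda>h. (u (x + h *\<^sub>R (w - x)) - u x) / h \<le> u w - u x) (at_right 0)"
    proof eventually_elim
      case (elim h)
      have "u ((1 - h) *\<^sub>R x + h *\<^sub>R w) < (1 - h) * u x + h * u w"
        using conv elim that unfolding strictly_convex_def by fastforce
      moreover have "(1 - h) *\<^sub>R x + h *\<^sub>R w = x + h *\<^sub>R (w - x)" by (simp add: algebra_simps)
      ultimately show ?case using elim by (simp add: field_simps)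
    qed
    then have "(w - x) \<bullet> g \<le> u w - u x"
      by (rule tendsto_upperbound[OF lim]) simp
    then show ?thesis by (simp add: inner_commute)
  qed
  \<comment> \<open>The weak inequality bounds \<open>u m\<close> from below by \<open>u x\<close>
    plus half the tangent increment, and strict convexity puts \<open>u m\<close> strictly below the
    mean of \<open>u x\<close> and \<open>u y\<close>.\<close>
  define m where "m = (1 - 1/2) *\<^sub>R x + (1/2) *\<^sub>R y"
  have m: "m - x = (1/2) *\<^sub>R (y - x)" by (simp add: m_def algebra_simps flip: scaleR_2)
  have "m \<noteq> x" using \<open>x \<noteq> y\<close> m by auto
  have "u m < (1 - 1/2) * u x + 1/2 * u y"
    unfolding m_def using conv \<open>x \<noteq> y\<close> unfolding strictly_convex_def
    by (metis field_sum_of_halves half_gt_zero less_add_same_cancel1 zero_less_one)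
  with weak[OF \<open>m \<noteq> x\<close>] show ?thesis by (simp add: m)
qed

text \<open>Adding the strict tangent inequalities based at \<open>x\<close> and at \<open>y\<close>
  cancels the values of \<open>\<phi>\<close>.\<close>

lemma strictly_monotone_gradient:
  assumes "C2 \<phi>" "strictly_convex \<phi>" "x \<noteq> y"
  shows "0 < (gradient \<phi> x - gradient \<phi> y) \<bullet> (x - y)"
  using strictly_convex_above_tangent[OF assms(2) C2_gderiv[OF assms(1)] assms(3)]
    strictly_convex_above_tangent[OF assms(2) C2_gderiv[OF assms(1)] assms(3)[symmetric]]
  by (simp add: inner_diff_left inner_diff_right)

text \<open>This is the Bregman divergence of \<open>psi \<phi>\<close> with base point
  \<open>z\<close>, isolated because it is the exponent of \<open>tangent_exp\<close> up to the
  factor \<open>- a\<close>.\<close>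

definition tangent_gap :: "(real^2 \<Rightarrow> real) \<Rightarrow> real^2 \<Rightarrow> real^2 \<Rightarrow> real" where
  "tangent_gap \<phi> z y = psi \<phi> y - psi \<phi> z - gradient (psi \<phi>) z \<bullet> (y - z)"

lemma tangent_exp_eq: "tangent_exp \<phi> a z y = of_real (exp (- a * tangent_gap \<phi> z y))"
  by (simp add: tangent_exp_def tangent_gap_def)

lemma tangent_gap_eq:
  assumes "C2 \<phi>"
  shows "tangent_gap \<phi> z y = (norm (y - z))\<^sup>2 + (\<phi> y - \<phi> z - gradient \<phi> z \<bullet> (y - z))"
  by (simp add: tangent_gap_def gradient_psi[OF assms] psi_def power2_norm_eq_inner
      inner_diff_left inner_diff_right inner_add_left inner_commute algebra_simps)

text \<open>The paraboloid contributes exactly the squared distance, and the graph of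
  \<open>\<phi>\<close> lies above its tangents. Hence tangential exponentials decay at least as
  fast as Gaussians.\<close>

lemma tangent_gap_ge:
  assumes "C2 \<phi>" "strictly_convex \<phi>"
  shows "(norm (y - z))\<^sup>2 \<le> tangent_gap \<phi> z y"
  using strictly_convex_above_tangent[OF assms(2) C2_gderiv[OF assms(1)], of z y]
  by (cases "z = y") (auto simp: tangent_gap_eq[OF assms(1)])

text \<open>Near a point with small Hessian the gap is almost as small as its lower bound.
  Differentiability of the gradient at \<open>z\<close> controls the increment of the gradient
  linearly, with an extra slope \<open>\<epsilon>'\<close> as small as desired.\<close>

lemma tangent_gap_upper:
  assumes C2: "C2 \<phi>" and conv: "strictly_convex \<phi>"
    and hess: "\<And>v. norm (hessian \<phi> z *v v) \<le> \<epsilon> * norm v" and "0 < \<epsilon>'"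
  shows "\<exists>\<delta>>0. \<forall>y. norm (y - z) < \<delta> \<longrightarrow> tangent_gap \<phi> z y \<le> (1 + \<epsilon> + \<epsilon>') * (norm (y - z))\<^sup>2"
proof -
  have "gradient \<phi> differentiable (at z)" using C2 by (simp add: C2_def)
  then have "(gradient \<phi> has_derivative (\<lambda>h. hessian \<phi> z *v h)) (at z)"
    unfolding hessian_def by (rule jacobian_works[THEN iffD1])
  then have "\<exists>\<delta>>0. \<forall>y. norm (y - z) < \<delta> \<longrightarrow>
      norm (gradient \<phi> y - gradient \<phi> z - hessian \<phi> z *v (y - z)) \<le> \<epsilon>' * norm (y - z)"
    using \<open>0 < \<epsilon>'\<close> unfolding has_derivative_at_alt by blast
  then obtain \<delta> where \<delta>: "\<delta> > 0" "\<And>y. norm (y - z) < \<delta> \<Longrightarrow>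
      norm (gradient \<phi> y - gradient \<phi> z - hessian \<phi> z *v (y - z)) \<le> \<epsilon>' * norm (y - z)"
    by blast
  have "tangent_gap \<phi> z y \<le> (1 + \<epsilon> + \<epsilon>') * (norm (y - z))\<^sup>2" if y: "norm (y - z) < \<delta>" for y
  proof -
    have "norm (gradient \<phi> y - gradient \<phi> z)
        \<le> norm (gradient \<phi> y - gradient \<phi> z - hessian \<phi> z *v (y - z)) + norm (hessian \<phi> z *v (y - z))"
      by (metis diff_add_cancel norm_triangle_ineq)
    also have "\<dots> \<le> (\<epsilon> + \<epsilon>') * norm (y - z)"
      using \<delta>(2)[OF y] hess[of "y - z"] by (simp add: algebra_simps)
    finally have n: "norm (gradient \<phi> y - gradient \<phi> z) \<le> (\<epsilon> + \<epsilon>') * norm (y - z)" .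
    \<comment> \<open>The tangent at \<open>y\<close> replaces a second-order Taylor expansion at \<open>z\<close>, at the harmless cost of a factor 2.\<close>
    have "\<phi> y - \<phi> z - gradient \<phi> z \<bullet> (y - z) \<le> (gradient \<phi> y - gradient \<phi> z) \<bullet> (y - z)"
      using strictly_convex_above_tangent[OF conv C2_gderiv[OF C2], of y z]
      by (cases "y = z") (auto simp: inner_diff_left inner_diff_right)
    also have "\<dots> \<le> norm (gradient \<phi> y - gradient \<phi> z) * norm (y - z)" by (rule norm_cauchy_schwarz)
    also have "\<dots> \<le> (\<epsilon> + \<epsilon>') * (norm (y - z))\<^sup>2"
      using mult_right_mono[OF n, of "norm (y - z)"] by (simp add: power2_eq_square algebra_simps)
    finally show ?thesis by (simp add: tangent_gap_eq[OF C2] algebra_simps)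
  qed
  with \<delta>(1) show ?thesis by blast
qed

section \<open>Changes of variables in the plane\<close>

lemma nn_integral_even:
  fixes f :: "real \<Rightarrow> ennreal"
  assumes [measurable]: "f \<in> borel_measurable borel" and even: "\<And>x. f (- x) = f x"
  shows "(\<integral>\<^sup>+x. f x \<partial>lborel) = 2 * (\<integral>\<^sup>+x. f x * indicator {0..} x \<partial>lborel)"
proof -
  \<comment> \<open>The two half-lines share the point 0, so the integrands agree only almost
    everywhere.\<close>
  have "(\<integral>\<^sup>+x. f x \<partial>lborel) = (\<integral>\<^sup>+x. f x * indicator {0..} x + f x * indicator {..0} x \<partial>lborel)"
    by (rule nn_integral_cong_AE, rule AE_mp[OF AE_lborel_singleton[of 0]])
       (auto split: split_indicator)
  also have "\<dots> = (\<integral>\<^sup>+x. f x * indicator {0..} x \<partial>lborel) + (\<integral>\<^sup>+x. f x * indicator {..0} x \<partial>lborel)"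
    by (rule nn_integral_add) auto
  also have "(\<integral>\<^sup>+x. f x * indicator {..0} x \<partial>lborel)
      = ennreal \<bar>-1\<bar> * (\<integral>\<^sup>+x. f (0 + -1 * x) * indicator {..0} (0 + -1 * x) \<partial>lborel)"
    by (rule nn_integral_real_affine) auto
  also have "\<dots> = (\<integral>\<^sup>+x. f x * indicator {0..} x \<partial>lborel)"
    by (auto intro!: nn_integral_cong simp: even split: split_indicator)
  finally show ?thesis by (simp add: mult_2)
qed

text \<open>Each half-line contributes one copy of the range of \<open>\<kappa>\<close>, whence the
  factor 2. Only an inequality results because \<open>\<kappa>\<close> need not reach the whole real
  line. The substitution is made on compact intervals and extended by monotone convergence.\<close>

lemma nn_integral_substitution_even:
  fixes \<kappa> \<kappa>' :: "real \<Rightarrow> real" and H :: "real \<Rightarrow> ennreal"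
  assumes [measurable]: "H \<in> borel_measurable borel"
    and deriv: "\<And>s. (\<kappa> has_real_derivative \<kappa>' s) (at s)"
    and cont: "continuous_on UNIV \<kappa>'"
    and nonneg: "\<And>s. 0 \<le> s \<Longrightarrow> 0 \<le> \<kappa>' s"
    and even: "\<And>s. \<kappa> (- s) = \<kappa> s" "\<And>s. \<kappa>' (- s) = - \<kappa>' s"
  shows "(\<integral>\<^sup>+s. H (\<kappa> s) * ennreal \<bar>\<kappa>' s\<bar> \<partial>lborel) \<le> 2 * (\<integral>\<^sup>+t. H t \<partial>lborel)"
proof -
  have "continuous_on UNIV \<kappa>"
    using deriv by (meson DERIV_isCont continuous_at_imp_continuous_on)
  then have [measurable]: "\<kappa> \<in> borel_measurable borel" by (rule borel_measurable_continuous_onI)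
  have [measurable]: "\<kappa>' \<in> borel_measurable borel" using cont by (rule borel_measurable_continuous_onI)
  let ?f = "\<lambda>n s. H (\<kappa> s) * ennreal (\<kappa>' s) * indicator {0..real n} s"
  have "(\<lambda>n. \<integral>\<^sup>+s. ?f n s \<partial>lborel) \<longlonglongrightarrow> (\<integral>\<^sup>+s. H (\<kappa> s) * ennreal (\<kappa>' s) * indicator {0..} s \<partial>lborel)"
  proof (rule nn_integral_LIMSEQ)
    show "incseq ?f"
      by (auto simp: incseq_def le_fun_def split: split_indicator)
    fix s
    have "eventually (\<lambda>n. ?f n s = H (\<kappa> s) * ennreal (\<kappa>' s) * indicator {0..} s) sequentially"
      using eventually_ge_at_top[of "nat \<lceil>s\<rceil>"]
      by eventually_elim (auto simp: nat_ceiling_le_eq split: split_indicator)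
    then show "(\<lambda>n. ?f n s) \<longlonglongrightarrow> H (\<kappa> s) * ennreal (\<kappa>' s) * indicator {0..} s"
      by (rule tendsto_eventually)
  qed simp
  \<comment> \<open>The substitution rule asks for an interval with distinct end points, hence
    \<open>n \<ge> 1\<close>.\<close>
  moreover have "(\<integral>\<^sup>+s. ?f n s \<partial>lborel) \<le> (\<integral>\<^sup>+t. H t \<partial>lborel)" if "n \<ge> 1" for n
  proof -
    have "(\<integral>\<^sup>+s. ?f n s \<partial>lborel) = (\<integral>\<^sup>+t. H t * indicator {\<kappa> 0..\<kappa> (real n)} t \<partial>lborel)"
      using that by (intro nn_integral_substitution_aux[symmetric] deriv)
        (auto intro: nonneg continuous_on_subset[OF cont])
    also have "\<dots> \<le> (\<integral>\<^sup>+t. H t \<partial>lborel)"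
      by (intro nn_integral_mono) (auto split: split_indicator)
    finally show ?thesis .
  qed
  ultimately have half: "(\<integral>\<^sup>+s. H (\<kappa> s) * ennreal (\<kappa>' s) * indicator {0..} s \<partial>lborel) \<le> (\<integral>\<^sup>+t. H t \<partial>lborel)"
    by (intro LIMSEQ_le_const2) blast+
  have "(\<integral>\<^sup>+s. H (\<kappa> s) * ennreal \<bar>\<kappa>' s\<bar> \<partial>lborel)
      = 2 * (\<integral>\<^sup>+s. H (\<kappa> s) * ennreal \<bar>\<kappa>' s\<bar> * indicator {0..} s \<partial>lborel)"
    by (rule nn_integral_even) (auto simp: even)
  also have "(\<integral>\<^sup>+s. H (\<kappa> s) * ennreal \<bar>\<kappa>' s\<bar> * indicator {0..} s \<partial>lborel)
      = (\<integral>\<^sup>+s. H (\<kappa> s) * ennreal (\<kappa>' s) * indicator {0..} s \<partial>lborel)"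
    by (intro nn_integral_cong) (auto simp: nonneg split: split_indicator)
  finally show ?thesis using half by (simp add: mult_left_mono)
qed

text \<open>For the direction \<open>e = (1, m)\<close> the integrand is \<open>1 / |e|^2\<close>;
  its integral over all slopes is where \<open>pi\<close> in the sharp constant comes from.\<close>

lemma nn_integral_inverse_one_plus_square:
  "(\<integral>\<^sup>+m. ennreal (1 / (1 + m\<^sup>2)) \<partial>lborel) = ennreal pi"
proof -
  have "(\<integral>\<^sup>+m. ennreal (1 / (1 + m\<^sup>2)) \<partial>lborel)
      = 2 * (\<integral>\<^sup>+m. ennreal (1 / (1 + m\<^sup>2)) * indicator {0..} m \<partial>lborel)"
    by (rule nn_integral_even) auto
  also have "(\<integral>\<^sup>+m. ennreal (1 / (1 + m\<^sup>2)) * indicator {0..} m \<partial>lborel) = ennreal (pi / 2 - arctan 0)"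
    by (rule nn_integral_FTC_atLeast)
       (auto intro!: derivative_eq_intros tendsto_arctan_at_top simp: inverse_eq_divide)
  also have "2 * \<dots> = ennreal pi" by (simp flip: ennreal_numeral ennreal_mult')
  finally show ?thesis .
qed

lemma Basis_real2: "(Basis :: (real^2) set) = {axis 1 1, axis 2 1}"
  by (auto simp: Basis_vec_def) (metis exhaust_2)

lemma axis_real2_neq: "(axis 1 1 :: real^2) \<noteq> axis 2 1"
  by (simp add: axis_eq_axis)

text \<open>Lebesgue measure is determined by its values on boxes. The explicit form opens the way
  to iterated integrals over the two coordinates.\<close>

lemma lborel_real2:
  "(lborel :: (real^2) measure)
    = distr (lborel \<Otimes>\<^sub>M lborel) borel (\<lambda>p. fst p *\<^sub>R axis 1 1 + snd p *\<^sub>R axis 2 1)" (is "_ = distr _ _ ?T")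
proof (rule lborel_eqI)
  fix l u :: "real^2"
  assume le: "\<And>b. b \<in> Basis \<Longrightarrow> l \<bullet> b \<le> u \<bullet> b"
  have [measurable]: "?T \<in> borel_measurable (lborel \<Otimes>\<^sub>M lborel)" by measurable
  have "l $ 1 \<le> u $ 1" "l $ 2 \<le> u $ 2"
    using le[of "axis 1 1"] le[of "axis 2 1"] by (simp_all add: Basis_real2 inner_axis)
  moreover have "?T -` box l u \<inter> space (lborel \<Otimes>\<^sub>M lborel) = {l $ 1<..<u $ 1} \<times> {l $ 2<..<u $ 2}"
    by (auto simp: mem_box_cart forall_2 space_pair_measure axis_def)
  ultimately show "emeasure (distr (lborel \<Otimes>\<^sub>M lborel) borel ?T) (box l u) = (\<Prod>b\<in>Basis. (u - l) \<bullet> b)"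
    by (simp add: emeasure_distr lborel.emeasure_pair_measure_Times Basis_real2 axis_real2_neq inner_axis
        ennreal_mult')
qed simp

text \<open>Parametrizing lines through the origin by their slope replaces polar coordinates, so that only
  one-dimensional substitutions are needed.\<close>

lemma nn_integral_real2_slopes:
  fixes g :: "real^2 \<Rightarrow> ennreal"
  assumes [measurable]: "g \<in> borel_measurable borel"
  shows "(\<integral>\<^sup>+z. g z \<partial>lborel)
    = (\<integral>\<^sup>+m. \<integral>\<^sup>+s. ennreal \<bar>s\<bar> * g (s *\<^sub>R (axis 1 1 + m *\<^sub>R axis 2 1)) \<partial>lborel \<partial>lborel)"
proof -
  have "(\<integral>\<^sup>+z. g z \<partial>lborel)
      = (\<integral>\<^sup>+p. g (fst p *\<^sub>R axis 1 1 + snd p *\<^sub>R axis 2 1) \<partial>(lborel \<Otimes>\<^sub>M lborel))"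
    by (subst lborel_real2, subst nn_integral_distr) simp_all
  also have "\<dots> = (\<integral>\<^sup>+s. \<integral>\<^sup>+t. g (s *\<^sub>R axis 1 1 + t *\<^sub>R axis 2 1) \<partial>lborel \<partial>lborel)"
    by (subst lborel.nn_integral_fst[symmetric]) simp_all
  also have "\<dots> = (\<integral>\<^sup>+s. \<integral>\<^sup>+m. ennreal \<bar>s\<bar> * g (s *\<^sub>R (axis 1 1 + m *\<^sub>R axis 2 1)) \<partial>lborel \<partial>lborel)"
  proof (rule nn_integral_cong_AE, rule AE_mp[OF AE_lborel_singleton[of 0]], rule AE_I2, rule impI)
    fix s :: real assume "s \<noteq> 0"
    then have "(\<integral>\<^sup>+t. g (s *\<^sub>R axis 1 1 + t *\<^sub>R axis 2 1) \<partial>lborel)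
        = ennreal \<bar>s\<bar> * (\<integral>\<^sup>+m. g (s *\<^sub>R axis 1 1 + (0 + s * m) *\<^sub>R axis 2 1) \<partial>lborel)"
      by (intro nn_integral_real_affine) measurable
    then show "(\<integral>\<^sup>+t. g (s *\<^sub>R axis 1 1 + t *\<^sub>R axis 2 1) \<partial>lborel)
        = (\<integral>\<^sup>+m. ennreal \<bar>s\<bar> * g (s *\<^sub>R (axis 1 1 + m *\<^sub>R axis 2 1)) \<partial>lborel)"
      by (simp add: nn_integral_cmult scaleR_add_right)
  qed
  also have "\<dots> = (\<integral>\<^sup>+m. \<integral>\<^sup>+s. ennreal \<bar>s\<bar> * g (s *\<^sub>R (axis 1 1 + m *\<^sub>R axis 2 1)) \<partial>lborel \<partial>lborel)"
    by (rule lborel_pair.Fubini') simp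
  finally show ?thesis .
qed

lemma nn_integral_lborel_translate:
  fixes g :: "'a::euclidean_space \<Rightarrow> ennreal"
  assumes [measurable]: "g \<in> borel_measurable borel"
  shows "(\<integral>\<^sup>+x. g (c + x) \<partial>lborel) = (\<integral>\<^sup>+x. g x \<partial>lborel)"
  by (subst (2) lborel_distr_plus[of c, symmetric]) (simp add: nn_integral_distr)

text \<open>Here \<open>\<xi>\<close> is the sum and \<open>z\<close> half the difference of the two
  points. The Jacobian has modulus 1: two translations and one exchange of the order of integration
  suffice.\<close>

lemma nn_integral_midpoint_difference:
  fixes g :: "'a::euclidean_space \<times> 'a \<Rightarrow> ennreal"
  assumes [measurable]: "g \<in> borel_measurable borel"
  shows "(\<integral>\<^sup>+p. g p \<partial>lborel)
    = (\<integral>\<^sup>+\<xi>. \<integral>\<^sup>+z. g ((1/2) *\<^sub>R \<xi> + z, (1/2) *\<^sub>R \<xi> - z) \<partial>lborel \<partial>lborel)"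
proof -
  have gp: "g \<in> borel_measurable (borel \<Otimes>\<^sub>M borel)" by (simp add: borel_prod)
  note [measurable] = gp
  have "(\<integral>\<^sup>+p. g p \<partial>lborel) = (\<integral>\<^sup>+x. \<integral>\<^sup>+y. g (x, y) \<partial>lborel \<partial>lborel)"
    by (simp add: lborel.nn_integral_fst flip: lborel_prod)
  also have "\<dots> = (\<integral>\<^sup>+x. \<integral>\<^sup>+\<xi>. g (x, - x + \<xi>) \<partial>lborel \<partial>lborel)"
    by (intro nn_integral_cong nn_integral_lborel_translate[symmetric]) simp
  also have "\<dots> = (\<integral>\<^sup>+\<xi>. \<integral>\<^sup>+x. g (x, - x + \<xi>) \<partial>lborel \<partial>lborel)"
    by (rule lborel_pair.Fubini') measurable
  also have "\<dots> = (\<integral>\<^sup>+\<xi>. \<integral>\<^sup>+z. g ((1/2) *\<^sub>R \<xi> + z, - ((1/2) *\<^sub>R \<xi> + z) + \<xi>) \<partial>lborel \<partial>lborel)"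
    by (intro nn_integral_cong nn_integral_lborel_translate[symmetric]) simp
  also have "\<dots> = (\<integral>\<^sup>+\<xi>. \<integral>\<^sup>+z. g ((1/2) *\<^sub>R \<xi> + z, (1/2) *\<^sub>R \<xi> - z) \<partial>lborel \<partial>lborel)"
  proof -
    have "- ((1/2) *\<^sub>R \<xi> + z) + \<xi> = (1/2) *\<^sub>R \<xi> - z" for \<xi> z :: 'a
      by (simp add: algebra_simps flip: scaleR_add_left)
    then show ?thesis by (simp only:)
  qed
  finally show ?thesis .
qed

section \<open>The weighted change of variables for the sum map\<close>

definition sum_map :: "(real^2 \<Rightarrow> real) \<Rightarrow> (real^2) \<times> (real^2) \<Rightarrow> (real^2) \<times> real" where
  "sum_map \<phi> p = (fst p + snd p, psi \<phi> (fst p) + psi \<phi> (snd p))"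

text \<open>On the diagonal the quotient is \<open>0 / 0\<close>, which is 0, so the weight is 1
  there and the lower bound 1 holds everywhere.\<close>

definition weight :: "(real^2 \<Rightarrow> real) \<Rightarrow> (real^2) \<times> (real^2) \<Rightarrow> real" where
  "weight \<phi> p = 1 + (gradient \<phi> (fst p) - gradient \<phi> (snd p)) \<bullet> (fst p - snd p)
     / (2 * (norm (fst p - snd p))\<^sup>2)"

lemma C2_borel_measurable: "C2 \<phi> \<Longrightarrow> \<phi> \<in> borel_measurable borel"
  by (rule borel_measurable_continuous_onI[OF C2_continuous])

lemma gradient_borel_measurable: "C2 \<phi> \<Longrightarrow> gradient \<phi> \<in> borel_measurable borel"
  by (rule borel_measurable_continuous_onI[OF C2_continuous_gradient])

lemma psi_borel_measurable:
  assumes "C2 \<phi>"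
  shows "psi \<phi> \<in> borel_measurable borel"
proof -
  note [measurable] = C2_borel_measurable[OF assms]
  show ?thesis unfolding psi_def[abs_def] by measurable
qed

lemma sum_map_borel_measurable:
  assumes "C2 \<phi>"
  shows "sum_map \<phi> \<in> borel_measurable borel"
proof -
  note [measurable] = psi_borel_measurable[OF assms]
  show ?thesis unfolding sum_map_def[abs_def] borel_prod[symmetric] by measurable
qed

lemma weight_borel_measurable:
  assumes "C2 \<phi>"
  shows "weight \<phi> \<in> borel_measurable borel"
proof -
  note [measurable] = gradient_borel_measurable[OF assms]
  show ?thesis unfolding weight_def[abs_def] borel_prod[symmetric] by measurable
qed

lemma weight_gt_1:
  assumes "C2 \<phi>" "strictly_convex \<phi>" "fst p \<noteq> snd p"
  shows "1 < weight \<phi> p"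
  using strictly_monotone_gradient[OF assms] assms(3) by (simp add: weight_def)

lemma weight_ge_1:
  assumes "C2 \<phi>" "strictly_convex \<phi>"
  shows "1 \<le> weight \<phi> p"
  using weight_gt_1[OF assms, of p] by (cases "fst p = snd p") (auto simp: weight_def)

text \<open>The weight is made so that \<open>\<bar>s\<bar>\<close> times the weight is a constant
  multiple of \<open>\<bar>\<kappa>' s\<bar>\<close>. The substitution \<open>t = \<kappa> s\<close>
  therefore absorbs the weight and the Jacobian of the slope coordinates together. The constant is
  \<open>1 / (4 * (norm e)^2)\<close>, doubled by the two half-lines.\<close>

lemma slope_integral_bound:
  fixes \<phi> :: "real^2 \<Rightarrow> real" and e \<eta> :: "real^2" and H :: "real \<Rightarrow> ennreal"
  assumes C2: "C2 \<phi>" and conv: "strictly_convex \<phi>" and [measurable]: "H \<in> borel_measurable borel"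
    and "e \<noteq> 0"
  shows "(\<integral>\<^sup>+s. ennreal \<bar>s\<bar> * (H (psi \<phi> (\<eta> + s *\<^sub>R e) + psi \<phi> (\<eta> - s *\<^sub>R e))
      * ennreal (weight \<phi> (\<eta> + s *\<^sub>R e, \<eta> - s *\<^sub>R e))) \<partial>lborel)
    \<le> ennreal (1 / (2 * (norm e)\<^sup>2)) * (\<integral>\<^sup>+t. H t \<partial>lborel)"
proof -
  define \<kappa> where "\<kappa> s = psi \<phi> (\<eta> + s *\<^sub>R e) + psi \<phi> (\<eta> - s *\<^sub>R e)" for s
  define \<Delta> where "\<Delta> s = e \<bullet> (gradient \<phi> (\<eta> + s *\<^sub>R e) - gradient \<phi> (\<eta> - s *\<^sub>R e))" for s
  define \<kappa>' where "\<kappa>' s = 4 * s * (norm e)\<^sup>2 + \<Delta> s" for s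
  have deriv: "(\<kappa> has_real_derivative \<kappa>' s) (at s)" for s
  proof -
    have psi_deriv: "((\<lambda>s. psi \<phi> (\<eta> + s *\<^sub>R d)) has_real_derivative d \<bullet> (2 *\<^sub>R (\<eta> + s *\<^sub>R d) + gradient \<phi> (\<eta> + s *\<^sub>R d))) (at s)"
      for d
      using GDERIV_add[OF gderiv_norm_square C2_gderiv[OF C2]]
      by (intro gderiv_along_line) (simp add: psi_def[abs_def])
    have "((\<lambda>s. psi \<phi> (\<eta> + s *\<^sub>R e) + psi \<phi> (\<eta> + s *\<^sub>R (- e))) has_real_derivative \<kappa>' s) (at s)"
      by (rule derivative_eq_intros psi_deriv refl)+
         (simp add: \<kappa>'_def \<Delta>_def inner_add_right inner_diff_right power2_norm_eq_inner)
    then show ?thesis by (simp add: \<kappa>_def[abs_def])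
  qed
  have "continuous_on UNIV \<kappa>'"
  proof -
    have "continuous_on UNIV (\<lambda>s. gradient \<phi> (\<eta> + s *\<^sub>R e))" "continuous_on UNIV (\<lambda>s. gradient \<phi> (\<eta> - s *\<^sub>R e))"
      by (rule continuous_on_compose2[OF C2_continuous_gradient[OF C2]]; auto intro!: continuous_intros)+
    then show ?thesis unfolding \<kappa>'_def \<Delta>_def by (intro continuous_intros)
  qed
  \<comment> \<open>By monotonicity of the gradient, \<open>\<Delta> s\<close> never has the sign
    opposite to \<open>s\<close>, so the two summands of \<open>\<kappa>' s\<close> cannot
    cancel.\<close>
  have \<Delta>: "0 \<le> s * \<Delta> s" for s
  proof (cases "s = 0")
    case False
    have "\<eta> + s *\<^sub>R e \<noteq> \<eta> - s *\<^sub>R e"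
      using False \<open>e \<noteq> 0\<close> by (simp add: eq_diff_eq add.assoc flip: scaleR_2)
    from strictly_monotone_gradient[OF C2 conv this]
    moreover have "(\<eta> + s *\<^sub>R e) - (\<eta> - s *\<^sub>R e) = (2 * s) *\<^sub>R e"
      by (simp flip: scaleR_add_left)
    ultimately have "0 < (2 * s) * \<Delta> s"
      by (simp add: \<Delta>_def inner_commute)
    then show ?thesis by simp
  qed simp
  have abs: "\<bar>\<kappa>' s\<bar> = 4 * \<bar>s\<bar> * (norm e)\<^sup>2 + \<bar>\<Delta> s\<bar>" for s
  proof -
    have "\<bar>4 * s * (norm e)\<^sup>2 + \<Delta> s\<bar> = \<bar>4 * s * (norm e)\<^sup>2\<bar> + \<bar>\<Delta> s\<bar>"
    proof -
      consider "s > 0" | "s = 0" | "s < 0" by linarith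
      then show ?thesis
      proof cases
        case 1
        then have "0 \<le> 4 * s * (norm e)\<^sup>2" "0 \<le> \<Delta> s" using \<Delta>[of s] by (auto simp: zero_le_mult_iff)
        then show ?thesis by linarith
      next
        case 3
        then have "4 * s * (norm e)\<^sup>2 \<le> 0" "\<Delta> s \<le> 0"
          using \<Delta>[of s] by (auto simp: zero_le_mult_iff mult_le_0_iff)
        then show ?thesis by linarith
      qed simp
    qed
    then show ?thesis by (simp add: \<kappa>'_def abs_mult)
  qed
  \<comment> \<open>The two points differ by \<open>2 * s\<close> times \<open>e\<close>, so off
    \<open>s = 0\<close> the quotient in the weight is
    \<open>\<Delta> s / (4 * s * (norm e)^2)\<close>; at \<open>s = 0\<close> both sides
    vanish.\<close>
  have jac: "\<bar>s\<bar> * weight \<phi> (\<eta> + s *\<^sub>R e, \<eta> - s *\<^sub>R e) = \<bar>\<kappa>' s\<bar> * (1 / (4 * (norm e)\<^sup>2))" for s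
  proof (cases "s = 0")
    case True
    then show ?thesis by (simp add: \<kappa>'_def \<Delta>_def)
  next
    case False
    have "(\<eta> + s *\<^sub>R e) - (\<eta> - s *\<^sub>R e) = (2 * s) *\<^sub>R e"
      by (simp flip: scaleR_add_left)
    then have "weight \<phi> (\<eta> + s *\<^sub>R e, \<eta> - s *\<^sub>R e) = 1 + (2 * s) * \<Delta> s / (2 * (\<bar>2 * s\<bar> * norm e)\<^sup>2)"
      by (simp add: weight_def \<Delta>_def inner_commute)
    then show ?thesis
      using False \<Delta>[of s] \<open>e \<noteq> 0\<close> unfolding abs
      by (cases "s > 0") (auto simp: field_simps power2_eq_square zero_le_mult_iff abs_if)
  qed
  have "continuous_on UNIV \<kappa>"
    using deriv by (meson DERIV_isCont continuous_at_imp_continuous_on)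
  then have [measurable]: "\<kappa> \<in> borel_measurable borel" by (rule borel_measurable_continuous_onI)
  have [measurable]: "\<kappa>' \<in> borel_measurable borel"
    using \<open>continuous_on UNIV \<kappa>'\<close> by (rule borel_measurable_continuous_onI)
  have "(\<integral>\<^sup>+s. ennreal \<bar>s\<bar> * (H (\<kappa> s) * ennreal (weight \<phi> (\<eta> + s *\<^sub>R e, \<eta> - s *\<^sub>R e))) \<partial>lborel)
      = (\<integral>\<^sup>+s. ennreal (1 / (4 * (norm e)\<^sup>2)) * (H (\<kappa> s) * ennreal \<bar>\<kappa>' s\<bar>) \<partial>lborel)"
  proof (rule nn_integral_cong)
    fix s
    have "ennreal \<bar>s\<bar> * (H (\<kappa> s) * ennreal (weight \<phi> (\<eta> + s *\<^sub>R e, \<eta> - s *\<^sub>R e)))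
        = H (\<kappa> s) * ennreal (\<bar>s\<bar> * weight \<phi> (\<eta> + s *\<^sub>R e, \<eta> - s *\<^sub>R e))"
      by (simp add: ennreal_mult' mult_ac)
    also have "\<dots> = ennreal (1 / (4 * (norm e)\<^sup>2)) * (H (\<kappa> s) * ennreal \<bar>\<kappa>' s\<bar>)"
      unfolding jac by (subst ennreal_mult') (simp_all add: mult_ac)
    finally show "ennreal \<bar>s\<bar> * (H (\<kappa> s) * ennreal (weight \<phi> (\<eta> + s *\<^sub>R e, \<eta> - s *\<^sub>R e)))
        = ennreal (1 / (4 * (norm e)\<^sup>2)) * (H (\<kappa> s) * ennreal \<bar>\<kappa>' s\<bar>)" .
  qed
  also have "\<dots> = ennreal (1 / (4 * (norm e)\<^sup>2)) * (\<integral>\<^sup>+s. H (\<kappa> s) * ennreal \<bar>\<kappa>' s\<bar> \<partial>lborel)"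
    by (rule nn_integral_cmult) measurable
  also have "\<dots> \<le> ennreal (1 / (4 * (norm e)\<^sup>2)) * (2 * (\<integral>\<^sup>+t. H t \<partial>lborel))"
  proof (intro mult_left_mono nn_integral_substitution_even deriv \<open>continuous_on UNIV \<kappa>'\<close>)
    show "0 \<le> \<kappa>' s" if "0 \<le> s" for s
      using that \<Delta>[of s] by (cases "s = 0") (auto simp: \<kappa>'_def \<Delta>_def zero_le_mult_iff)
  qed (auto simp: \<kappa>_def \<kappa>'_def \<Delta>_def inner_diff_right)
  also have "\<dots> = ennreal (1 / (2 * (norm e)\<^sup>2)) * (\<integral>\<^sup>+t. H t \<partial>lborel)"
  proof -
    have "ennreal (1 / (2 * (norm e)\<^sup>2)) = ennreal (1 / (4 * (norm e)\<^sup>2)) * 2"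
      by (simp flip: ennreal_numeral ennreal_mult)
    then show ?thesis by (simp add: mult.assoc)
  qed
  finally show ?thesis unfolding \<kappa>_def .
qed

text \<open>Midpoint coordinates freeze the first component \<open>\<xi>\<close> of
  \<open>sum_map\<close>, and slopes reduce the inner integral to lines through the midpoint.
  Integrating the factor \<open>1 / (2 * (1 + m^2))\<close> over \<open>m\<close> gives
  \<open>pi / 2\<close>.\<close>

theorem nn_integral_sum_map_weight_le:
  fixes \<phi> :: "real^2 \<Rightarrow> real" and G :: "(real^2) \<times> real \<Rightarrow> ennreal"
  assumes C2: "C2 \<phi>" and conv: "strictly_convex \<phi>" and G: "G \<in> borel_measurable borel"
  shows "(\<integral>\<^sup>+p. G (sum_map \<phi> p) * ennreal (weight \<phi> p) \<partial>lborel) \<le> ennreal (pi / 2) * (\<integral>\<^sup>+q. G q \<partial>lborel)"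
proof -
  note [measurable] = weight_borel_measurable[OF C2] sum_map_borel_measurable[OF C2] psi_borel_measurable[OF C2] G
  have Gp[measurable]: "G \<in> borel_measurable (borel \<Otimes>\<^sub>M borel)" using G by (simp add: borel_prod)
  have Wp[measurable]: "weight \<phi> \<in> borel_measurable (borel \<Otimes>\<^sub>M borel)"
    using weight_borel_measurable[OF C2] by (simp add: borel_prod)
  have "(\<integral>\<^sup>+p. G (sum_map \<phi> p) * ennreal (weight \<phi> p) \<partial>lborel)
     = (\<integral>\<^sup>+\<xi>. \<integral>\<^sup>+z. G (\<xi>, psi \<phi> ((1/2) *\<^sub>R \<xi> + z) + psi \<phi> ((1/2) *\<^sub>R \<xi> - z))
          * ennreal (weight \<phi> ((1/2) *\<^sub>R \<xi> + z, (1/2) *\<^sub>R \<xi> - z)) \<partial>lborel \<partial>lborel)"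
    by (subst nn_integral_midpoint_difference, measurable) (simp add: sum_map_def flip: scaleR_add_left)
  also have "\<dots> \<le> (\<integral>\<^sup>+\<xi>. ennreal (pi / 2) * (\<integral>\<^sup>+t. G (\<xi>, t) \<partial>lborel) \<partial>lborel)"
  proof (rule nn_integral_mono)
    fix \<xi> :: "real^2"
    let ?e = "\<lambda>m. axis 1 1 + m *\<^sub>R axis 2 1 :: real^2"
    have norm_e: "(norm (?e m))\<^sup>2 = 1 + m\<^sup>2" for m
      by (simp add: power2_norm_eq_inner inner_add_left inner_add_right inner_axis_axis)
         (simp add: power2_eq_square)
    have e: "?e m \<noteq> 0" for m
      using norm_e[of m] by (metis norm_zero not_sum_power2_lt_zero power_zero_numeral
          less_add_one add_less_same_cancel1 power_one zero_less_one sum_power2_eq_zero_iff zero_neq_one)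
    have "(\<integral>\<^sup>+z. G (\<xi>, psi \<phi> ((1/2) *\<^sub>R \<xi> + z) + psi \<phi> ((1/2) *\<^sub>R \<xi> - z))
          * ennreal (weight \<phi> ((1/2) *\<^sub>R \<xi> + z, (1/2) *\<^sub>R \<xi> - z)) \<partial>lborel)
      = (\<integral>\<^sup>+m. \<integral>\<^sup>+s. ennreal \<bar>s\<bar> * (G (\<xi>, psi \<phi> ((1/2) *\<^sub>R \<xi> + s *\<^sub>R ?e m) + psi \<phi> ((1/2) *\<^sub>R \<xi> - s *\<^sub>R ?e m))
          * ennreal (weight \<phi> ((1/2) *\<^sub>R \<xi> + s *\<^sub>R ?e m, (1/2) *\<^sub>R \<xi> - s *\<^sub>R ?e m))) \<partial>lborel \<partial>lborel)"
      by (rule nn_integral_real2_slopes) measurable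
    also have "\<dots> \<le> (\<integral>\<^sup>+m. ennreal (1 / (2 * (norm (?e m))\<^sup>2)) * (\<integral>\<^sup>+t. G (\<xi>, t) \<partial>lborel) \<partial>lborel)"
      by (intro nn_integral_mono slope_integral_bound C2 conv e) measurable
    also have "\<dots> = (\<integral>\<^sup>+m. ennreal (1 / 2) * ennreal (1 / (1 + m\<^sup>2)) \<partial>lborel) * (\<integral>\<^sup>+t. G (\<xi>, t) \<partial>lborel)"
    proof -
      have "ennreal (1 / (2 * (1 + m\<^sup>2))) = ennreal (1 / 2) * ennreal (1 / (1 + m\<^sup>2))" for m :: real
        by (subst ennreal_mult[symmetric]) simp_all
      then show ?thesis unfolding norm_e by (simp only:) (rule nn_integral_multc, measurable)
    qed
    also have "\<dots> = ennreal (pi / 2) * (\<integral>\<^sup>+t. G (\<xi>, t) \<partial>lborel)"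
      by (subst nn_integral_cmult, measurable)
         (subst nn_integral_inverse_one_plus_square, subst ennreal_mult[symmetric], simp_all)
    finally show "(\<integral>\<^sup>+z. G (\<xi>, psi \<phi> ((1/2) *\<^sub>R \<xi> + z) + psi \<phi> ((1/2) *\<^sub>R \<xi> - z))
          * ennreal (weight \<phi> ((1/2) *\<^sub>R \<xi> + z, (1/2) *\<^sub>R \<xi> - z)) \<partial>lborel)
      \<le> ennreal (pi / 2) * (\<integral>\<^sup>+t. G (\<xi>, t) \<partial>lborel)" .
  qed
  also have "\<dots> = ennreal (pi / 2) * (\<integral>\<^sup>+\<xi>. \<integral>\<^sup>+t. G (\<xi>, t) \<partial>lborel \<partial>lborel)"
    by (rule nn_integral_cmult) measurable
  also have "(\<integral>\<^sup>+\<xi>. \<integral>\<^sup>+t. G (\<xi>, t) \<partial>lborel \<partial>lborel) = (\<integral>\<^sup>+q. G q \<partial>lborel)"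
    by (simp add: lborel.nn_integral_fst flip: lborel_prod)
  finally show ?thesis .
qed

section \<open>Densities of push-forwards under the sum map\<close>

text \<open>The weighted inequality for the indicator of \<open>B\<close> has right-hand side 0, and
  the weight is at least 1. This is what makes push-forwards under \<open>sum_map\<close> absolutely
  continuous.\<close>

lemma AE_sum_map:
  fixes \<phi> :: "real^2 \<Rightarrow> real"
  assumes C2: "C2 \<phi>" and conv: "strictly_convex \<phi>" and B: "B \<in> null_sets lborel"
  shows "AE p in lborel. sum_map \<phi> p \<notin> B"
proof -
  note [measurable] = weight_borel_measurable[OF C2] sum_map_borel_measurable[OF C2]
  have [measurable]: "B \<in> sets borel" using B by auto
  have "(\<integral>\<^sup>+p. indicator B (sum_map \<phi> p) * ennreal (weight \<phi> p) \<partial>lborel)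
      \<le> ennreal (pi / 2) * (\<integral>\<^sup>+q. indicator B q \<partial>lborel)"
    by (rule nn_integral_sum_map_weight_le[OF C2 conv]) measurable
  also have "\<dots> = 0" using B by auto
  finally have "AE p in lborel. indicator B (sum_map \<phi> p) * ennreal (weight \<phi> p) = 0"
    by (subst (asm) le_zero_eq, subst (asm) nn_integral_0_iff_AE) measurable
  then show ?thesis
  proof eventually_elim
    case (elim p)
    then show ?case using weight_ge_1[OF C2 conv, of p] by (auto simp: indicator_def split: if_splits)
  qed
qed

text \<open>Radon-Nikodym applies by \<open>AE_sum_map\<close>. The push-forward is finite on balls
  by \<open>loc\<close>, so the density is finite almost everywhere and can be taken
  real-valued.\<close>

lemma pushforward_density_real:
  fixes \<phi> :: "real^2 \<Rightarrow> real" and u :: "(real^2) \<times> (real^2) \<Rightarrow> real"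
  assumes C2: "C2 \<phi>" and conv: "strictly_convex \<phi>"
    and u [measurable]: "u \<in> borel_measurable borel" and u0: "\<And>p. 0 \<le> u p"
    and loc: "\<And>n::nat. integrable lborel (\<lambda>p. indicator (cball 0 (real n)) (sum_map \<phi> p) *\<^sub>R u p)"
  shows "\<exists>D. D \<in> borel_measurable borel \<and> (\<forall>q. 0 \<le> D q) \<and>
    density lborel (\<lambda>q. ennreal (D q)) = distr (density lborel (\<lambda>p. ennreal (u p))) borel (sum_map \<phi>)"
proof -
  note [measurable] = sum_map_borel_measurable[OF C2] borel_closed[OF closed_cball]
  let ?N = "distr (density lborel (\<lambda>p. ennreal (u p))) borel (sum_map \<phi>)"
  have N: "emeasure ?N B = (\<integral>\<^sup>+p. ennreal (u p) * indicator B (sum_map \<phi> p) \<partial>lborel)"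
    if [measurable]: "B \<in> sets borel" for B
  proof -
    have "emeasure ?N B = emeasure (density lborel (\<lambda>p. ennreal (u p))) (sum_map \<phi> -` B)"
      by (subst emeasure_distr) simp_all
    also have "\<dots> = (\<integral>\<^sup>+p. ennreal (u p) * indicator (sum_map \<phi> -` B) p \<partial>lborel)"
      using measurable_sets_borel[OF sum_map_borel_measurable[OF C2] that]
      by (intro emeasure_density) auto
    finally show ?thesis by (simp add: indicator_def)
  qed
  have "absolutely_continuous lborel ?N"
    unfolding absolutely_continuous_def
  proof
    fix B :: "((real^2) \<times> real) set" assume B: "B \<in> null_sets lborel"
    then have [measurable]: "B \<in> sets borel" by auto
    have "emeasure ?N B = (\<integral>\<^sup>+(p :: (real^2) \<times> (real^2)). 0 \<partial>lborel)"
      unfolding N[OF \<open>B \<in> sets borel\<close>]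
      by (rule nn_integral_cong_AE) (use AE_sum_map[OF C2 conv B] in eventually_elim, simp)
    then show "B \<in> null_sets ?N" by auto
  qed
  then obtain D where D [measurable]: "D \<in> borel_measurable lborel" and DN: "density lborel D = ?N"
    using sigma_finite_measure.Radon_Nikodym[OF sigma_finite_lborel, of ?N] by auto
  have "AE q in lborel. q \<in> cball 0 (real n) \<longrightarrow> D q < \<infinity>" for n
  proof -
    have "(\<integral>\<^sup>+q. D q * indicator (cball 0 (real n)) q \<partial>lborel) = emeasure ?N (cball 0 (real n))"
      by (simp add: emeasure_density flip: DN)
    also have "\<dots> = (\<integral>\<^sup>+p. ennreal (norm (indicator (cball 0 (real n)) (sum_map \<phi> p) *\<^sub>R u p)) \<partial>lborel)"
      by (subst N) (auto intro!: nn_integral_cong simp: u0 split: split_indicator)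
    also have "\<dots> < \<infinity>" using loc[of n] unfolding integrable_iff_bounded by simp
    finally have "AE q in lborel. D q * indicator (cball 0 (real n)) q \<noteq> \<infinity>"
      by (intro nn_integral_PInf_AE) auto
    then show ?thesis by eventually_elim (auto simp: less_top)
  qed
  then have "AE q in lborel. \<forall>n. q \<in> cball 0 (real n) \<longrightarrow> D q < \<infinity>"
    by (subst AE_all_countable) blast
  then have fin: "AE q in lborel. D q = ennreal (enn2real (D q))"
  proof eventually_elim
    case (elim q)
    moreover obtain n where "q \<in> cball 0 (real n)" using real_arch_simple by auto
    ultimately show ?case by auto
  qed
  have "density lborel (\<lambda>q. ennreal (enn2real (D q))) = density lborel D"
    by (rule density_cong) (use fin in \<open>auto elim: eventually_mono\<close>)
  with DN show ?thesis by (intro exI[of _ "\<lambda>q. enn2real (D q)"]) auto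
qed

lemma pushforward_integral_real:
  fixes \<phi> :: "real^2 \<Rightarrow> real" and u :: "(real^2) \<times> (real^2) \<Rightarrow> real"
  assumes C2: "C2 \<phi>" and conv: "strictly_convex \<phi>"
    and u [measurable]: "u \<in> borel_measurable borel" and u0: "\<And>p. 0 \<le> u p"
    and loc: "\<And>n::nat. integrable lborel (\<lambda>p. indicator (cball 0 (real n)) (sum_map \<phi> p) *\<^sub>R u p)"
  shows "\<exists>D::_ \<Rightarrow> real. D \<in> borel_measurable borel \<and> (\<forall>G :: _ \<Rightarrow> complex. G \<in> borel_measurable borel \<longrightarrow>
    integrable lborel (\<lambda>p. u p *\<^sub>R G (sum_map \<phi> p)) \<longrightarrow>
    integrable lborel (\<lambda>q. D q *\<^sub>R G q) \<and>
    (LINT q|lborel. D q *\<^sub>R G q) = (LINT p|lborel. u p *\<^sub>R G (sum_map \<phi> p)))"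
proof -
  note [measurable] = sum_map_borel_measurable[OF C2] borel_closed[OF closed_cball]
  from pushforward_density_real[OF assms] obtain D
    where D [measurable]: "D \<in> borel_measurable borel" and D0: "\<And>q. 0 \<le> D q"
      and eq: "density lborel (\<lambda>q. ennreal (D q)) = distr (density lborel (\<lambda>p. ennreal (u p))) borel (sum_map \<phi>)"
    by blast
  have "integrable lborel (\<lambda>q. D q *\<^sub>R G q) \<and>
    (LINT q|lborel. D q *\<^sub>R G q) = (LINT p|lborel. u p *\<^sub>R G (sum_map \<phi> p))"
    if [measurable]: "G \<in> borel_measurable borel" and int: "integrable lborel (\<lambda>p. u p *\<^sub>R G (sum_map \<phi> p))"
    for G :: "_ \<Rightarrow> complex"
  proof
    show "integrable lborel (\<lambda>q. D q *\<^sub>R G q)"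
      by (subst integrable_density[symmetric])
         (use int in \<open>auto simp: D0 eq integrable_distr_eq integrable_density u0\<close>)
    show "(LINT q|lborel. D q *\<^sub>R G q) = (LINT p|lborel. u p *\<^sub>R G (sum_map \<phi> p))"
      by (subst integral_density[symmetric]) (auto simp: D0 eq integral_distr integral_density u0)
  qed
  with D show ?thesis by blast
qed

text \<open>The positive and negative parts of \<open>Re u\<close> and \<open>Im u\<close> are
  dominated by \<open>cmod u\<close>, so each satisfies the local hypothesis and has a real density;
  \<open>F\<close> reassembles the four. A single \<open>F\<close> serves all test functions
  \<open>G\<close>.\<close>

lemma pushforward_integral:
  fixes \<phi> :: "real^2 \<Rightarrow> real" and u :: "(real^2) \<times> (real^2) \<Rightarrow> complex"
  assumes C2: "C2 \<phi>" and conv: "strictly_convex \<phi>"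
    and u [measurable]: "u \<in> borel_measurable borel"
    and loc: "\<And>n::nat. integrable lborel (\<lambda>p. indicator (cball 0 (real n)) (sum_map \<phi> p) *\<^sub>R u p)"
  shows "\<exists>F::_ \<Rightarrow> complex. F \<in> borel_measurable borel \<and> (\<forall>G. G \<in> borel_measurable borel \<longrightarrow>
    integrable lborel (\<lambda>p. G (sum_map \<phi> p) * u p) \<longrightarrow>
    integrable lborel (\<lambda>q. G q * F q) \<and>
    (LINT q|lborel. G q * F q) = (LINT p|lborel. G (sum_map \<phi> p) * u p))"
proof -
  note [measurable] = sum_map_borel_measurable[OF C2] borel_closed[OF closed_cball]
  have part: "\<exists>D::_ \<Rightarrow> real. D \<in> borel_measurable borel \<and> (\<forall>G :: _ \<Rightarrow> complex. G \<in> borel_measurable borel \<longrightarrow>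
    integrable lborel (\<lambda>p. G (sum_map \<phi> p) * u p) \<longrightarrow>
    integrable lborel (\<lambda>p. v p *\<^sub>R G (sum_map \<phi> p)) \<and> integrable lborel (\<lambda>q. D q *\<^sub>R G q) \<and>
    (LINT q|lborel. D q *\<^sub>R G q) = (LINT p|lborel. v p *\<^sub>R G (sum_map \<phi> p)))"
    if v [measurable]: "v \<in> borel_measurable borel" and v0: "\<And>p. 0 \<le> v p" and vu: "\<And>p. v p \<le> cmod (u p)" for v
  proof -
    have "integrable lborel (\<lambda>p. indicator (cball 0 (real n)) (sum_map \<phi> p) *\<^sub>R v p)" for n :: nat
      by (rule Bochner_Integration.integrable_bound[OF loc[of n]])
         (measurable, auto simp: v0 vu intro!: mult_left_mono)
    from pushforward_integral_real[OF C2 conv v v0 this] obtain D :: "_ \<Rightarrow> real"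
      where "D \<in> borel_measurable borel" and D: "\<And>G :: _ \<Rightarrow> complex. G \<in> borel_measurable borel \<Longrightarrow>
        integrable lborel (\<lambda>p. v p *\<^sub>R G (sum_map \<phi> p)) \<Longrightarrow>
        integrable lborel (\<lambda>q. D q *\<^sub>R G q) \<and>
        (LINT q|lborel. D q *\<^sub>R G q) = (LINT p|lborel. v p *\<^sub>R G (sum_map \<phi> p))" by blast
    moreover have "integrable lborel (\<lambda>p. v p *\<^sub>R G (sum_map \<phi> p))"
      if [measurable]: "G \<in> borel_measurable borel" and "integrable lborel (\<lambda>p. G (sum_map \<phi> p) * u p)"
      for G :: "_ \<Rightarrow> complex"
      by (rule Bochner_Integration.integrable_bound[OF that(2)])
         (auto simp: v0 vu norm_mult mult.commute[of "cmod (u _)"] mult_left_mono mult.commute[of "v _"])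
    ultimately show ?thesis by blast
  qed
  have bounds: "max 0 (Re z) \<le> cmod z" "max 0 (- Re z) \<le> cmod z" "max 0 (Im z) \<le> cmod z" "max 0 (- Im z) \<le> cmod z" for z
    using abs_Re_le_cmod[of z] abs_Im_le_cmod[of z] by auto
  obtain D1 where D1 [measurable]: "D1 \<in> borel_measurable borel" and D1: "\<And>G :: _ \<Rightarrow> complex. G \<in> borel_measurable borel \<Longrightarrow>
    integrable lborel (\<lambda>p. G (sum_map \<phi> p) * u p) \<Longrightarrow>
    integrable lborel (\<lambda>p. max 0 (Re (u p)) *\<^sub>R G (sum_map \<phi> p)) \<and> integrable lborel (\<lambda>q. (D1 q::real) *\<^sub>R G q) \<and>
    (LINT q|lborel. D1 q *\<^sub>R G q) = (LINT p|lborel. max 0 (Re (u p)) *\<^sub>R G (sum_map \<phi> p))"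
    using part[of "\<lambda>p. max 0 (Re (u p))"] bounds by auto
  obtain D2 where D2 [measurable]: "D2 \<in> borel_measurable borel" and D2: "\<And>G :: _ \<Rightarrow> complex. G \<in> borel_measurable borel \<Longrightarrow>
    integrable lborel (\<lambda>p. G (sum_map \<phi> p) * u p) \<Longrightarrow>
    integrable lborel (\<lambda>p. max 0 (- Re (u p)) *\<^sub>R G (sum_map \<phi> p)) \<and> integrable lborel (\<lambda>q. (D2 q::real) *\<^sub>R G q) \<and>
    (LINT q|lborel. D2 q *\<^sub>R G q) = (LINT p|lborel. max 0 (- Re (u p)) *\<^sub>R G (sum_map \<phi> p))"
    using part[of "\<lambda>p. max 0 (- Re (u p))"] bounds by auto
  obtain D3 where D3 [measurable]: "D3 \<in> borel_measurable borel" and D3: "\<And>G :: _ \<Rightarrow> complex. G \<in> borel_measurable borel \<Longrightarrow>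
    integrable lborel (\<lambda>p. G (sum_map \<phi> p) * u p) \<Longrightarrow>
    integrable lborel (\<lambda>p. max 0 (Im (u p)) *\<^sub>R G (sum_map \<phi> p)) \<and> integrable lborel (\<lambda>q. (D3 q::real) *\<^sub>R G q) \<and>
    (LINT q|lborel. D3 q *\<^sub>R G q) = (LINT p|lborel. max 0 (Im (u p)) *\<^sub>R G (sum_map \<phi> p))"
    using part[of "\<lambda>p. max 0 (Im (u p))"] bounds by auto
  obtain D4 where D4 [measurable]: "D4 \<in> borel_measurable borel" and D4: "\<And>G :: _ \<Rightarrow> complex. G \<in> borel_measurable borel \<Longrightarrow>
    integrable lborel (\<lambda>p. G (sum_map \<phi> p) * u p) \<Longrightarrow>
    integrable lborel (\<lambda>p. max 0 (- Im (u p)) *\<^sub>R G (sum_map \<phi> p)) \<and> integrable lborel (\<lambda>q. (D4 q::real) *\<^sub>R G q) \<and>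
    (LINT q|lborel. D4 q *\<^sub>R G q) = (LINT p|lborel. max 0 (- Im (u p)) *\<^sub>R G (sum_map \<phi> p))"
    using part[of "\<lambda>p. max 0 (- Im (u p))"] bounds by auto
  define F where "F q = Complex (D1 q - D2 q) (D3 q - D4 q)" for q
  have F: "G q * F q = (D1 q *\<^sub>R G q - D2 q *\<^sub>R G q) + \<i> * (D3 q *\<^sub>R G q - D4 q *\<^sub>R G q)" for G :: "_ \<Rightarrow> complex" and q
    by (simp add: complex_eq_iff F_def algebra_simps)
  have U: "G (sum_map \<phi> p) * u p = (max 0 (Re (u p)) *\<^sub>R G (sum_map \<phi> p) - max 0 (- Re (u p)) *\<^sub>R G (sum_map \<phi> p))
      + \<i> * (max 0 (Im (u p)) *\<^sub>R G (sum_map \<phi> p) - max 0 (- Im (u p)) *\<^sub>R G (sum_map \<phi> p))" for G :: "_ \<Rightarrow> complex" and p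
    by (simp add: complex_eq_iff max_def algebra_simps)
  have "F \<in> borel_measurable borel"
    unfolding F_def[abs_def] Complex_eq by measurable
  moreover have "integrable lborel (\<lambda>q. G q * F q) \<and>
    (LINT q|lborel. G q * F q) = (LINT p|lborel. G (sum_map \<phi> p) * u p)"
    if G: "G \<in> borel_measurable borel" and int: "integrable lborel (\<lambda>p. G (sum_map \<phi> p) * u p)" for G
    using D1[OF G int] D2[OF G int] D3[OF G int] D4[OF G int]
    unfolding F U by simp
  ultimately show ?thesis by blast
qed

section \<open>The weighted bound for the density\<close>

text \<open>Duality against a truncation \<open>G\<close> of \<open>cnj F\<close>: the pairing is a
  truncated integral of \<open>(cmod F)^2\<close>. On the other side AM-GM separates
  \<open>(cmod u)^2 / weight\<close> from \<open>(cmod G)^2 * weight\<close>, and the weighted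
  change of variables sends the latter back to the same truncated integral.\<close>

lemma weighted_L2_bound:
  fixes \<phi> :: "real^2 \<Rightarrow> real" and u :: "(real^2) \<times> (real^2) \<Rightarrow> complex"
    and F :: "(real^2) \<times> real \<Rightarrow> complex"
  assumes C2: "C2 \<phi>" and conv: "strictly_convex \<phi>"
    and u [measurable]: "u \<in> borel_measurable borel"
    and loc: "\<And>n::nat. integrable lborel (\<lambda>p. indicator (cball 0 (real n)) (sum_map \<phi> p) *\<^sub>R u p)"
    and F [measurable]: "F \<in> borel_measurable borel"
    and repr: "\<And>G. G \<in> borel_measurable borel \<Longrightarrow> integrable lborel (\<lambda>p. G (sum_map \<phi> p) * u p) \<Longrightarrow>
      integrable lborel (\<lambda>q. G q * F q) \<and>
      (LINT q|lborel. G q * F q) = (LINT p|lborel. G (sum_map \<phi> p) * u p)"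
  shows "(\<integral>\<^sup>+q. ennreal ((cmod (F q))\<^sup>2) \<partial>lborel)
    \<le> ennreal (pi / 2) * (\<integral>\<^sup>+p. ennreal ((cmod (u p))\<^sup>2 / weight \<phi> p) \<partial>lborel)"
    (is "_ \<le> _ * ?Q")
proof (cases "?Q = \<infinity>")
  case True
  then show ?thesis by (simp add: ennreal_mult_top)
next
  case False
  note [measurable] = sum_map_borel_measurable[OF C2] weight_borel_measurable[OF C2]
    borel_closed[OF closed_cball]
  have w: "1 \<le> weight \<phi> p" for p by (rule weight_ge_1[OF C2 conv])
  from False obtain Q where Q: "?Q = ennreal Q" "0 \<le> Q"
    by (cases ?Q) auto
  \<comment> \<open>\<open>F\<close> is not yet known to be square integrable. Bounding both
    position and modulus makes the pairing integrable by \<open>loc\<close> and keeps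
    \<open>I n\<close> finite.\<close>
  define E where "E n = {q \<in> cball 0 (real n). cmod (F q) \<le> real n}" for n
  have [measurable]: "E n \<in> sets borel" for n
    unfolding E_def by measurable
  define I where "I n = (\<integral>\<^sup>+q. ennreal ((cmod (F q))\<^sup>2) * indicator (E n) q \<partial>lborel)" for n
  have bound: "I n \<le> ennreal (pi / 2 * Q)" for n
  proof -
    define G where "G q = cnj (F q) * indicator (E n) q" for q
    have [measurable]: "(\<lambda>q. cnj (F q)) \<in> borel_measurable borel"
      using measurable_compose[OF F borel_measurable_continuous_onI[OF continuous_on_cnj[OF continuous_on_id]]] by simp
    have [measurable]: "G \<in> borel_measurable borel"
      unfolding G_def[abs_def] by measurable
    have Gu: "cmod (G q) \<le> real n * indicator (cball 0 (real n)) q" for q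
      by (auto simp: G_def E_def norm_mult split: split_indicator)
    have GF: "G q * F q = of_real ((cmod (F q))\<^sup>2 * indicator (E n) q)" for q
      using complex_norm_square[of "F q"] by (simp add: G_def mult_ac split: split_indicator)
    have "integrable lborel (\<lambda>p. G (sum_map \<phi> p) * u p)"
    proof (rule Bochner_Integration.integrable_bound)
      show "integrable lborel (\<lambda>p. real n *\<^sub>R (indicator (cball 0 (real n)) (sum_map \<phi> p) *\<^sub>R u p))"
        by (intro integrable_scaleR_right loc)
      show "AE p in lborel. norm (G (sum_map \<phi> p) * u p)
          \<le> norm (real n *\<^sub>R (indicator (cball 0 (real n)) (sum_map \<phi> p) *\<^sub>R u p))"
        by (rule AE_I2) (use Gu in \<open>auto simp: norm_mult mult_right_mono simp flip: mult.assoc\<close>)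
    qed measurable
    then have int: "integrable lborel (\<lambda>q. G q * F q)"
      and eq: "(LINT q|lborel. G q * F q) = (LINT p|lborel. G (sum_map \<phi> p) * u p)"
      using repr[of G] by auto
    have intR: "integrable lborel (\<lambda>q. (cmod (F q))\<^sup>2 * indicator (E n) q)"
      using int unfolding GF complex_of_real_integrable_eq .
    have I_eq: "I n = ennreal (LINT q|lborel. (cmod (F q))\<^sup>2 * indicator (E n) q)"
      unfolding I_def by (subst nn_integral_eq_integral[symmetric, OF intR])
        (auto intro!: nn_integral_cong split: split_indicator)
    define i where "i = (LINT q|lborel. (cmod (F q))\<^sup>2 * indicator (E n) q)"
    have i0: "0 \<le> i" unfolding i_def by (rule integral_nonneg_AE) auto
    have "ennreal i = ennreal (norm (LINT q|lborel. G q * F q))"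
      using i0 unfolding GF i_def by (simp only: integral_complex_of_real norm_of_real) simp
    also have "\<dots> \<le> (\<integral>\<^sup>+p. ennreal (norm (G (sum_map \<phi> p) * u p)) \<partial>lborel)"
      unfolding eq by (rule integral_norm_bound_ennreal) fact
    also have "\<dots> \<le> (\<integral>\<^sup>+p. ennreal (1 / pi) * (ennreal ((cmod (G (sum_map \<phi> p)))\<^sup>2) * ennreal (weight \<phi> p))
        + ennreal (pi / 4) * ennreal ((cmod (u p))\<^sup>2 / weight \<phi> p) \<partial>lborel)"
    proof (rule nn_integral_mono)
      fix p
      let ?g = "cmod (G (sum_map \<phi> p))" and ?v = "cmod (u p)" and ?w = "weight \<phi> p"
      \<comment> \<open>AM-GM, balanced so that the first term contributes exactly half of the left-hand side.\<close>
      have "0 \<le> (2 * ?w * ?g - pi * ?v)\<^sup>2 / (4 * pi * ?w)" using w[of p] by simp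
      also have "\<dots> = 1 / pi * (?g\<^sup>2 * ?w) + pi / 4 * (?v\<^sup>2 / ?w) - ?g * ?v"
        using w[of p] by (simp add: field_simps power2_eq_square)
      finally have "?g * ?v \<le> 1 / pi * (?g\<^sup>2 * ?w) + pi / 4 * (?v\<^sup>2 / ?w)" by simp
      then have "ennreal (norm (G (sum_map \<phi> p) * u p)) \<le> ennreal (1 / pi * (?g\<^sup>2 * ?w) + pi / 4 * (?v\<^sup>2 / ?w))"
        by (simp add: norm_mult ennreal_leI)
      also have "\<dots> = ennreal (1 / pi) * (ennreal (?g\<^sup>2) * ennreal ?w) + ennreal (pi / 4) * ennreal (?v\<^sup>2 / ?w)"
        using w[of p] by (simp add: ennreal_plus flip: ennreal_mult)
      finally show "ennreal (norm (G (sum_map \<phi> p) * u p))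
        \<le> ennreal (1 / pi) * (ennreal (?g\<^sup>2) * ennreal ?w) + ennreal (pi / 4) * ennreal (?v\<^sup>2 / ?w)" .
    qed
    also have "\<dots> = ennreal (1 / pi) * (\<integral>\<^sup>+p. ennreal ((cmod (G (sum_map \<phi> p)))\<^sup>2) * ennreal (weight \<phi> p) \<partial>lborel)
        + ennreal (pi / 4) * ?Q"
      by (subst nn_integral_add; (subst nn_integral_cmult)?; (subst nn_integral_cmult)?; measurable)
    also have "\<dots> \<le> ennreal (1 / pi) * (ennreal (pi / 2) * (\<integral>\<^sup>+q. ennreal ((cmod (G q))\<^sup>2) \<partial>lborel))
        + ennreal (pi / 4) * ?Q"
      by (intro add_right_mono mult_left_mono nn_integral_sum_map_weight_le[OF C2 conv]) measurable
    also have "(\<integral>\<^sup>+q. ennreal ((cmod (G q))\<^sup>2) \<partial>lborel) = I n"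
      unfolding I_def by (auto intro!: nn_integral_cong simp: G_def norm_mult split: split_indicator)
    also have "I n = ennreal i" by (simp add: I_eq i_def)
    also have "ennreal (1 / pi) * (ennreal (pi / 2) * ennreal i) + ennreal (pi / 4) * ?Q
        = ennreal (i / 2 + pi / 4 * Q)"
      unfolding Q(1) using i0 Q(2) by (simp flip: ennreal_mult ennreal_plus)
    \<comment> \<open>Because \<open>i\<close> is finite, half of it can be subtracted from both
      sides, leaving \<open>i \<le> pi / 2 * Q\<close>.\<close>
    finally have "i \<le> i / 2 + pi / 4 * Q"
      using i0 Q(2) by (subst (asm) ennreal_le_iff) auto
    then show ?thesis unfolding I_eq i_def[symmetric] by (intro ennreal_leI) simp
  qed
  have "(\<lambda>n. I n) \<longlonglongrightarrow> (\<integral>\<^sup>+q. ennreal ((cmod (F q))\<^sup>2) \<partial>lborel)"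
    unfolding I_def
  proof (rule nn_integral_LIMSEQ)
    show "incseq (\<lambda>n q. ennreal ((cmod (F q))\<^sup>2) * indicator (E n) q)"
      by (auto simp: incseq_def le_fun_def E_def split: split_indicator)
    fix q
    have "eventually (\<lambda>n. ennreal ((cmod (F q))\<^sup>2) * indicator (E n) q = ennreal ((cmod (F q))\<^sup>2)) sequentially"
      using eventually_ge_at_top[of "nat \<lceil>norm q\<rceil>"] eventually_ge_at_top[of "nat \<lceil>cmod (F q)\<rceil>"]
      by eventually_elim (auto simp: E_def nat_ceiling_le_eq)
    then show "(\<lambda>n. ennreal ((cmod (F q))\<^sup>2) * indicator (E n) q) \<longlonglongrightarrow> ennreal ((cmod (F q))\<^sup>2)"
      by (rule tendsto_eventually)
  qed measurable
  then have "(\<integral>\<^sup>+q. ennreal ((cmod (F q))\<^sup>2) \<partial>lborel) \<le> ennreal (pi / 2 * Q)"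
    by (rule LIMSEQ_le_const2) (use bound in auto)
  also have "\<dots> = ennreal (pi / 2) * ?Q" unfolding Q(1) using Q(2) by (simp flip: ennreal_mult)
  finally show ?thesis .
qed

section \<open>Tensor squares, their local integrability, and the convolution integral\<close>

lemma nn_integral_lborel_times:
  fixes g :: "'a::euclidean_space \<Rightarrow> ennreal" and h :: "'b::euclidean_space \<Rightarrow> ennreal"
  assumes [measurable]: "g \<in> borel_measurable borel" "h \<in> borel_measurable borel"
  shows "(\<integral>\<^sup>+p. g (fst p) * h (snd p) \<partial>lborel) = (\<integral>\<^sup>+x. g x \<partial>lborel) * (\<integral>\<^sup>+y. h y \<partial>lborel)"
proof -
  have "(\<integral>\<^sup>+p. g (fst p) * h (snd p) \<partial>lborel) = (\<integral>\<^sup>+x. \<integral>\<^sup>+y. g x * h y \<partial>lborel \<partial>lborel)"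
    unfolding lborel_prod[symmetric] by (subst lborel.nn_integral_fst[symmetric]) simp_all
  then show ?thesis by (simp add: nn_integral_cmult nn_integral_multc)
qed

definition tensor_square :: "(real^2 \<Rightarrow> complex) \<Rightarrow> (real^2) \<times> (real^2) \<Rightarrow> complex" where
  "tensor_square f p = f (fst p) * f (snd p)"

lemma in_L2_measurable: "in_L2 f \<Longrightarrow> f \<in> borel_measurable borel"
  by (simp add: in_L2_def)

lemma L2_norm_nonneg: "0 \<le> L2_norm f"
  by (simp add: L2_norm_def integral_nonneg_AE)

lemma nn_integral_L2_norm:
  assumes "in_L2 f"
  shows "(\<integral>\<^sup>+x. ennreal ((cmod (f x))\<^sup>2) \<partial>lborel) = ennreal ((L2_norm f)\<^sup>2)"
  using assms by (simp add: in_L2_def L2_norm_def nn_integral_eq_integral integral_nonneg_AE)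

lemma in_L2_I:
  assumes [measurable]: "f \<in> borel_measurable borel"
    and fin: "(\<integral>\<^sup>+x. ennreal ((cmod (f x))\<^sup>2) \<partial>lborel) < \<infinity>"
  shows "in_L2 f"
  using fin by (auto simp: in_L2_def integrable_iff_bounded)

lemma tensor_square_measurable:
  assumes "f \<in> borel_measurable borel"
  shows "tensor_square f \<in> borel_measurable borel"
proof -
  note [measurable] = assms
  show ?thesis unfolding tensor_square_def[abs_def] borel_prod[symmetric] by measurable
qed

lemma nn_integral_tensor_square:
  assumes "in_L2 f"
  shows "(\<integral>\<^sup>+p. ennreal ((cmod (tensor_square f p))\<^sup>2) \<partial>lborel) = ennreal ((L2_norm f) ^ 4)"
proof -
  note [measurable] = in_L2_measurable[OF assms]
  have "(\<integral>\<^sup>+p. ennreal ((cmod (tensor_square f p))\<^sup>2) \<partial>lborel)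
      = (\<integral>\<^sup>+p. ennreal ((cmod (f (fst p)))\<^sup>2) * ennreal ((cmod (f (snd p)))\<^sup>2) \<partial>lborel)"
    by (simp add: tensor_square_def norm_mult power_mult_distrib ennreal_mult')
  also have "\<dots> = ennreal ((L2_norm f)\<^sup>2) * ennreal ((L2_norm f)\<^sup>2)"
    by (subst nn_integral_lborel_times) (simp_all add: nn_integral_L2_norm[OF assms])
  finally show ?thesis by (simp flip: ennreal_mult power_add)
qed

text \<open>As \<open>\<phi>\<close> is nonnegative, the last component of \<open>sum_map\<close>
  dominates the sum of the two squared norms. Preimages of balls are therefore bounded.\<close>

lemma sum_map_bounded_norms:
  assumes nonneg: "\<And>y. 0 \<le> \<phi> y" and "norm (sum_map \<phi> p) \<le> r"
  shows "norm (fst p) \<le> 1 + r" "norm (snd p) \<le> 1 + r"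
proof -
  have "psi \<phi> (fst p) + psi \<phi> (snd p) \<le> norm (sum_map \<phi> p)"
    by (metis sum_map_def norm_snd_le snd_conv real_norm_def abs_ge_self order_trans)
  then have "(norm (fst p))\<^sup>2 + (norm (snd p))\<^sup>2 \<le> r"
    using assms(2) nonneg[of "fst p"] nonneg[of "snd p"] by (simp add: psi_def)
  then have "(norm (fst p))\<^sup>2 \<le> r" "(norm (snd p))\<^sup>2 \<le> r"
    by (smt (verit) zero_le_power2)+
  \<comment> \<open>This passes from squared norms to norms without taking square roots.\<close>
  moreover have "x \<le> 1 + x\<^sup>2" for x :: real
    using zero_le_power2[of "x - 1/2"] by (simp add: power2_eq_square algebra_simps)
  ultimately show "norm (fst p) \<le> 1 + r" "norm (snd p) \<le> 1 + r"
    by (meson add_left_mono order_trans)+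
qed

text \<open>The preimage of the ball lies in a product of two balls, and \<open>f\<close> is
  integrable on balls because \<open>cmod (f x) \<le> 1 + (cmod (f x))^2\<close>.\<close>

lemma tensor_square_integrable_on_cball:
  assumes nonneg: "\<And>y. 0 \<le> \<phi> y" and C2: "C2 \<phi>" and f: "in_L2 f"
  shows "integrable lborel (\<lambda>p. indicator (cball 0 r) (sum_map \<phi> p) *\<^sub>R tensor_square f p)"
proof -
  note [measurable] = in_L2_measurable[OF f] tensor_square_measurable[OF in_L2_measurable[OF f]]
    sum_map_borel_measurable[OF C2] borel_closed[OF closed_cball]
  let ?B = "cball 0 (1 + r) :: (real^2) set"
  let ?h = "\<lambda>x. indicator ?B x * ennreal (cmod (f x))"
  have fin: "(\<integral>\<^sup>+x. ?h x \<partial>lborel) < \<infinity>"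
  proof -
    have "(\<integral>\<^sup>+x. ?h x \<partial>lborel) \<le> (\<integral>\<^sup>+x. indicator ?B x + ennreal ((cmod (f x))\<^sup>2) \<partial>lborel)"
    proof (rule nn_integral_mono)
      fix x
      have "cmod (f x) \<le> 1 + (cmod (f x))\<^sup>2"
        using zero_le_power2[of "cmod (f x) - 1/2"] by (simp add: power2_eq_square algebra_simps)
      then have "ennreal (cmod (f x)) \<le> 1 + ennreal ((cmod (f x))\<^sup>2)"
        by (metis ennreal_1 ennreal_leI ennreal_plus zero_le_one zero_le_power2)
      then show "?h x \<le> indicator ?B x + ennreal ((cmod (f x))\<^sup>2)"
        by (auto split: split_indicator)
    qed
    also have "\<dots> = emeasure lborel ?B + ennreal ((L2_norm f)\<^sup>2)"
      by (subst nn_integral_add) (simp_all add: nn_integral_L2_norm[OF f])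
    also have "\<dots> < \<infinity>"
      using emeasure_bounded_finite[of ?B] by (simp add: less_top[symmetric])
    finally show ?thesis .
  qed
  have "(\<integral>\<^sup>+p. ennreal (norm (indicator (cball 0 r) (sum_map \<phi> p) *\<^sub>R tensor_square f p)) \<partial>lborel)
      \<le> (\<integral>\<^sup>+p. ?h (fst p) * ?h (snd p) \<partial>lborel)"
    using sum_map_bounded_norms[OF nonneg]
    by (intro nn_integral_mono) (auto simp: tensor_square_def norm_mult ennreal_mult' split: split_indicator)
  also have "\<dots> = (\<integral>\<^sup>+x. ?h x \<partial>lborel) * (\<integral>\<^sup>+x. ?h x \<partial>lborel)"
    by (rule nn_integral_lborel_times) measurable
  also have "\<dots> < \<infinity>" using fin by (simp add: ennreal_mult_less_top)
  finally show ?thesis by (intro integrableI_bounded) measurable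
qed

text \<open>Integrals against the projection measure are Lebesgue integrals over the parameter
  plane, so the definition becomes an iterated integral; \<open>int\<close> lets Fubini turn it into
  one integral over pairs.\<close>

lemma fsigma_conv_eq:
  assumes C2: "C2 \<phi>" and f: "in_L2 f" and A: "A \<in> sets borel"
    and int: "integrable lborel (\<lambda>p. indicator A (sum_map \<phi> p) * tensor_square f p)"
  shows "fsigma_conv \<phi> f A = (LINT p|lborel. indicator A (sum_map \<phi> p) * tensor_square f p)"
proof -
  note [measurable] = in_L2_measurable[OF f] psi_borel_measurable[OF C2] A
  have Ap [measurable]: "A \<in> sets (borel \<Otimes>\<^sub>M borel)" unfolding borel_prod by (rule A)
  have graph: "(\<lambda>y. (y, psi \<phi> y)) \<in> borel_measurable lborel"
    unfolding borel_prod[symmetric] by measurable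
  have fs: "fsigma_integral \<phi> f g = (LINT y|lborel. g (y, psi \<phi> y) * f y)"
    if g: "g \<in> borel_measurable borel" for g
  proof -
    have [measurable]: "g \<in> borel_measurable (borel \<Otimes>\<^sub>M borel)" using g by (simp add: borel_prod)
    have "(\<lambda>p. g p * f (fst p)) \<in> borel_measurable borel"
      unfolding borel_prod[symmetric] by measurable
    then show ?thesis
      unfolding fsigma_integral_def proj_measure_def using graph by (simp add: integral_distr)
  qed
  have inner: "fsigma_integral \<phi> f (\<lambda>p. indicator A (p + q))
      = (LINT y|lborel. indicator A (y + fst q, psi \<phi> y + snd q) * f y)" for q
  proof -
    have add: "(y, t) + q = (y + fst q, t + snd q)" for y t by (simp add: prod_eq_iff)
    have "(\<lambda>p. indicator A (p + q) :: complex) \<in> borel_measurable borel" by measurable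
    from fs[OF this] show ?thesis by (simp add: add)
  qed
  have "fsigma_conv \<phi> f A = (LINT x|lborel. (LINT y|lborel. indicator A (y + x, psi \<phi> y + psi \<phi> x) * f y) * f x)"
    unfolding fsigma_conv_def inner
  proof (subst fs)
    have "(\<lambda>q. LINT y|lborel. indicator A (y + fst q, psi \<phi> y + snd q) * f y) \<in> borel_measurable (borel \<Otimes>\<^sub>M borel)"
      by measurable
    then show "(\<lambda>q. LINT y|lborel. indicator A (y + fst q, psi \<phi> y + snd q) * f y) \<in> borel_measurable borel"
      by (simp add: borel_prod)
  qed simp
  also have "\<dots> = (LINT x|lborel. LINT y|lborel. indicator A (sum_map \<phi> (x, y)) * tensor_square f (x, y))"
    by (simp add: sum_map_def tensor_square_def add.commute mult_ac flip: integral_mult_left_zero integral_mult_right_zero)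
  also have "\<dots> = (LINT p|lborel. indicator A (sum_map \<phi> p) * tensor_square f p)"
    using int unfolding lborel_prod[symmetric]
    by (rule lborel_pair.integral_fst')
  finally show ?thesis .
qed

section \<open>The norm of the convolution\<close>

text \<open>Integrals over bounded Borel sets determine a locally integrable function almost
  everywhere on each ball, and countably many balls exhaust the space. The value of
  \<open>conv_norm\<close> thus does not depend on the choice made by \<open>SOME\<close>.\<close>

lemma is_conv_density_unique:
  assumes F: "is_conv_density \<phi> f F" and F': "is_conv_density \<phi> f F'"
  shows "AE q in lborel. F q = F' q"
proof -
  have "AE q in lborel. q \<in> cball 0 (real n) \<longrightarrow> F q = F' q" for n
  proof -
    let ?B = "cball 0 (real n) :: ((real^2) \<times> real) set"
    have B: "?B \<in> sets borel" "bounded ?B" by (auto intro: borel_closed)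
    have AE: "AE q in lborel. indicator ?B q *\<^sub>R F q = indicator ?B q *\<^sub>R F' q"
    proof (rule sigma_finite_measure.density_unique_banach[OF sigma_finite_lborel])
      show "integrable lborel (\<lambda>q. indicator ?B q *\<^sub>R F q)" "integrable lborel (\<lambda>q. indicator ?B q *\<^sub>R F' q)"
        using F F' B unfolding is_conv_density_def set_integrable_def by blast+
      fix A :: "((real^2) \<times> real) set" assume "A \<in> sets lborel"
      then have "A \<inter> ?B \<in> sets borel" "bounded (A \<inter> ?B)" using B by auto
      then have "(LINT q:A \<inter> ?B|lborel. F q) = (LINT q:A \<inter> ?B|lborel. F' q)"
        using F F' unfolding is_conv_density_def by metis
      then show "(LINT q:A|lborel. indicator ?B q *\<^sub>R F q) = (LINT q:A|lborel. indicator ?B q *\<^sub>R F' q)"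
        unfolding set_lebesgue_integral_def by (simp add: indicator_inter_arith)
    qed
    then show ?thesis by eventually_elim auto
  qed
  then have "AE q in lborel. \<forall>n. q \<in> cball 0 (real n) \<longrightarrow> F q = F' q"
    by (subst AE_all_countable) blast
  then show ?thesis
  proof eventually_elim
    case (elim q)
    moreover obtain n where "q \<in> cball 0 (real n)" using real_arch_simple by auto
    ultimately show ?case by auto
  qed
qed

lemma L2_cong_AE:
  assumes [measurable]: "F \<in> borel_measurable borel" "F' \<in> borel_measurable borel"
    and AE: "AE q in lborel. F q = F' q"
  shows "in_L2 F \<longleftrightarrow> in_L2 F'" "L2_norm F = L2_norm F'"
proof -
  have eq: "AE q in lborel. (cmod (F q))\<^sup>2 = (cmod (F' q))\<^sup>2" using AE by eventually_elim simp
  have "integrable lborel (\<lambda>q. (cmod (F q))\<^sup>2) \<longleftrightarrow> integrable lborel (\<lambda>q. (cmod (F' q))\<^sup>2)"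
    by (rule integrable_cong_AE[OF _ _ eq]) measurable
  then show "in_L2 F \<longleftrightarrow> in_L2 F'" by (simp add: in_L2_def)
  have "(LINT q|lborel. (cmod (F q))\<^sup>2) = (LINT q|lborel. (cmod (F' q))\<^sup>2)"
    by (rule integral_cong_AE[OF _ _ eq]) measurable
  then show "L2_norm F = L2_norm F'" by (simp add: L2_norm_def)
qed

lemma conv_norm_eq:
  assumes F: "is_conv_density \<phi> f F" and "in_L2 F"
  shows "conv_norm \<phi> f = ereal (L2_norm F)"
proof -
  have dens: "is_conv_density \<phi> f (conv_density \<phi> f)"
    unfolding conv_density_def using F by (rule someI[of "is_conv_density \<phi> f"])
  have "AE q in lborel. F q = conv_density \<phi> f q" by (rule is_conv_density_unique[OF F dens])
  then have "in_L2 F \<longleftrightarrow> in_L2 (conv_density \<phi> f)" "L2_norm F = L2_norm (conv_density \<phi> f)"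
    using L2_cong_AE[of F "conv_density \<phi> f"] F dens by (simp_all add: is_conv_density_def)
  with assms show ?thesis unfolding conv_norm_def by auto
qed

text \<open>Cauchy-Schwarz from AM-GM with a free parameter \<open>t\<close>, which is best at the
  quotient of the two norms. If a norm vanishes there is no such optimum, and the bound is reached
  up to an arbitrary error \<open>e\<close>.\<close>

lemma L2_pairing_bound:
  fixes F G :: "'a::euclidean_space \<Rightarrow> complex"
  assumes F: "in_L2 F" and G: "in_L2 G"
  shows "cmod (LINT q|lborel. G q * F q) \<le> L2_norm F * L2_norm G"
proof -
  note [measurable] = in_L2_measurable[OF F] in_L2_measurable[OF G]
  let ?f = "(L2_norm F)\<^sup>2" and ?g = "(L2_norm G)\<^sup>2"
  have amgm: "cmod (LINT q|lborel. G q * F q) \<le> (t * ?g + ?f / t) / 2" if "t > 0" for t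
  proof -
    have int: "integrable lborel (\<lambda>q. (t * (cmod (G q))\<^sup>2 + (cmod (F q))\<^sup>2 / t) / 2)"
      using F G by (auto simp: in_L2_def)
    have pt: "cmod (G q * F q) \<le> (t * (cmod (G q))\<^sup>2 + (cmod (F q))\<^sup>2 / t) / 2" for q
    proof -
      have "0 \<le> (t * cmod (G q) - cmod (F q))\<^sup>2 / (2 * t)" using that by simp
      also have "\<dots> = (t * (cmod (G q))\<^sup>2 + (cmod (F q))\<^sup>2 / t) / 2 - cmod (G q) * cmod (F q)"
        using that by (simp add: field_simps power2_eq_square)
      finally show ?thesis by (simp add: norm_mult)
    qed
    have "cmod (LINT q|lborel. G q * F q) \<le> (LINT q|lborel. (t * (cmod (G q))\<^sup>2 + (cmod (F q))\<^sup>2 / t) / 2)"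
    proof (rule Bochner_Integration.integral_norm_bound_integral[OF _ int pt])
      show "integrable lborel (\<lambda>q. G q * F q)"
        by (rule Bochner_Integration.integrable_bound[OF int])
           (measurable, use order_trans[OF pt abs_ge_self] in simp)
    qed
    also have "\<dots> = (t * ?g + ?f / t) / 2"
      using F G by (simp add: in_L2_def L2_norm_def integral_nonneg_AE)
    finally show ?thesis .
  qed
  show ?thesis
  proof (cases "L2_norm F = 0 \<or> L2_norm G = 0")
    case False
    then have pos: "0 < L2_norm F" "0 < L2_norm G" using L2_norm_nonneg by (auto simp: less_le)
    then show ?thesis
      using amgm[of "L2_norm F / L2_norm G"] by (simp add: power2_eq_square field_simps)
  next
    case True
    show ?thesis
    proof (rule field_le_epsilon)
      fix e :: real assume "0 < e"
      show "cmod (LINT q|lborel. G q * F q) \<le> L2_norm F * L2_norm G + e"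
      proof (cases "L2_norm G = 0")
        case G0: True
        \<comment> \<open>With \<open>L2_norm G = 0\<close> only \<open>?f / t\<close> remains, so
          \<open>t\<close> is taken large enough to push it below \<open>e\<close>; the summand 1
          keeps \<open>t\<close> positive.\<close>
        define t where "t = ?f / e + 1"
        have "0 < t" using \<open>0 < e\<close> by (simp add: t_def add_nonneg_pos)
        moreover have "?f \<le> e * t" using \<open>0 < e\<close> by (simp add: t_def distrib_left)
        then have "?f / t \<le> e" using \<open>0 < t\<close> by (simp add: divide_le_eq)
        ultimately show ?thesis using amgm[of t] G0 \<open>0 < e\<close> by simp
      next
        case False
        then have F0: "L2_norm F = 0" "0 < ?g" using True by auto
        \<comment> \<open>With \<open>L2_norm F = 0\<close> only \<open>t * ?g\<close> remains, and
          this \<open>t\<close> makes it equal to \<open>e\<close>.\<close>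
        then show ?thesis using amgm[of "e / ?g"] \<open>0 < e\<close> by simp
      qed
    qed
  qed
qed

section \<open>The weighted energy and its comparison with the fourth power of the norm\<close>

definition weighted_energy :: "(real^2 \<Rightarrow> real) \<Rightarrow> (real^2 \<Rightarrow> complex) \<Rightarrow> ennreal" where
  "weighted_energy \<phi> f = (\<integral>\<^sup>+p. ennreal ((cmod (tensor_square f p))\<^sup>2 / weight \<phi> p) \<partial>lborel)"

lemma divide_weight_le:
  assumes "C2 \<phi>" "strictly_convex \<phi>" "0 \<le> r"
  shows "r / weight \<phi> p \<le> r"
  using weight_ge_1[OF assms(1,2), of p] mult_left_mono[OF weight_ge_1[OF assms(1,2), of p] assms(3)]
  by (simp add: divide_le_eq)

lemma weighted_energy_le:
  assumes C2: "C2 \<phi>" and conv: "strictly_convex \<phi>" and f: "in_L2 f"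
  shows "weighted_energy \<phi> f \<le> ennreal ((L2_norm f) ^ 4)"
  unfolding weighted_energy_def nn_integral_tensor_square[OF f, symmetric]
  by (intro nn_integral_mono ennreal_leI divide_weight_le[OF C2 conv]) simp

text \<open>Every slice of the diagonal is a single point, hence a null set.\<close>

lemma AE_off_diagonal: "AE p :: (real^2) \<times> (real^2) in lborel. fst p \<noteq> snd p"
proof -
  have "AE p :: (real^2) \<times> (real^2) in lborel \<Otimes>\<^sub>M lborel. fst p \<noteq> snd p"
  proof (rule lborel_pair.AE_pair_measure)
    show "{p \<in> space (lborel \<Otimes>\<^sub>M lborel). fst p \<noteq> snd p} \<in> sets (lborel \<Otimes>\<^sub>M (lborel :: (real^2) measure))"
      by measurable
    show "AE x in lborel. AE y in lborel. fst (x, y) \<noteq> snd (x, y :: real^2)"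
    proof (rule AE_I2)
      fix x :: "real^2"
      show "AE y in lborel. fst (x, y) \<noteq> snd (x, y)"
        using AE_lborel_singleton[of x] by eventually_elim simp
    qed
  qed
  then show ?thesis unfolding lborel_prod .
qed

text \<open>Equality would force the two integrands to agree almost everywhere. Since the weight
  exceeds 1 off the diagonal, the tensor square and then \<open>f\<close> would vanish almost
  everywhere. This strictness rules out extremizers.\<close>

lemma weighted_energy_less:
  assumes C2: "C2 \<phi>" and conv: "strictly_convex \<phi>" and f: "nonzero_L2 f"
  shows "weighted_energy \<phi> f < ennreal ((L2_norm f) ^ 4)"
proof (rule ccontr)
  have L2: "in_L2 f" using f by (simp add: nonzero_L2_def)
  note [measurable] = in_L2_measurable[OF L2] tensor_square_measurable[OF in_L2_measurable[OF L2]]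
    weight_borel_measurable[OF C2]
  let ?u = "\<lambda>p. (cmod (tensor_square f p))\<^sup>2" and ?w = "weight \<phi>"
  have w: "1 \<le> ?w p" for p by (rule weight_ge_1[OF C2 conv])
  assume "\<not> ?thesis"
  then have eq: "(\<integral>\<^sup>+p. ennreal (?u p / ?w p) \<partial>lborel) = ennreal ((L2_norm f) ^ 4)"
    using weighted_energy_le[OF C2 conv L2] unfolding weighted_energy_def by auto
  have le: "?u p / ?w p \<le> ?u p" for p by (rule divide_weight_le[OF C2 conv]) simp
  \<comment> \<open>The difference of integrals may be formed because the subtracted one is finite
    by \<open>eq\<close>.\<close>
  have "(\<integral>\<^sup>+p. ennreal (?u p) \<partial>lborel) - (\<integral>\<^sup>+p. ennreal (?u p / ?w p) \<partial>lborel)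
      = (\<integral>\<^sup>+p. ennreal (?u p) - ennreal (?u p / ?w p) \<partial>lborel)"
    by (rule nn_integral_diff[symmetric]) (auto simp: eq le intro!: ennreal_leI)
  then have "(\<integral>\<^sup>+p. ennreal (?u p) - ennreal (?u p / ?w p) \<partial>lborel) = 0"
    unfolding eq nn_integral_tensor_square[OF L2] by simp
  then have "AE p in lborel. ennreal (?u p) - ennreal (?u p / ?w p) = 0"
    by (subst (asm) nn_integral_0_iff_AE) auto
  then have "AE p in lborel. ennreal (?u p) = 0"
    using AE_off_diagonal
  proof eventually_elim
    case (elim p)
    have w1: "1 < ?w p" using weight_gt_1[OF C2 conv elim(2)] .
    have "0 \<le> ?u p / ?w p" using w1 by simp
    moreover have "ennreal (?u p) \<le> ennreal (?u p / ?w p)"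
      using elim(1) by (simp add: diff_eq_0_iff_ennreal)
    ultimately have "?u p \<le> ?u p / ?w p" by (simp only: ennreal_le_iff)
    with w1 have "?u p * ?w p \<le> ?u p" by (simp add: field_simps)
    then have "?u p * (?w p - 1) \<le> 0" by (simp add: algebra_simps)
    with w1 have "?u p \<le> 0" by (simp add: mult_le_0_iff)
    then show ?case by simp
  qed
  then have "(\<integral>\<^sup>+p. ennreal (?u p) \<partial>lborel) = 0"
    by (subst nn_integral_0_iff_AE) auto
  then have "L2_norm f = 0" unfolding nn_integral_tensor_square[OF L2] using L2_norm_nonneg[of f] by simp
  then have "(\<integral>\<^sup>+x. ennreal ((cmod (f x))\<^sup>2) \<partial>lborel) = 0" by (simp add: nn_integral_L2_norm[OF L2])
  then have "AE x in lborel. f x = 0"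
    by (subst (asm) nn_integral_0_iff_AE) auto
  then show False using f by (simp add: nonzero_L2_def)
qed

text \<open>The density is hidden behind its norm \<open>c\<close>: the energy bound yields upper
  estimates, and every test function \<open>G\<close> yields a lower estimate through the pairing
  inequality.\<close>

lemma conv_norm_characterization:
  assumes nonneg: "\<And>y. 0 \<le> \<phi> y" and C2: "C2 \<phi>" and conv: "strictly_convex \<phi>" and f: "in_L2 f"
  shows "\<exists>c\<ge>0. conv_norm \<phi> f = ereal c \<and> ennreal (c\<^sup>2) \<le> ennreal (pi / 2) * weighted_energy \<phi> f \<and>
    (\<forall>G. in_L2 G \<longrightarrow> integrable lborel (\<lambda>p. G (sum_map \<phi> p) * tensor_square f p) \<longrightarrow>
      cmod (LINT p|lborel. G (sum_map \<phi> p) * tensor_square f p) \<le> c * L2_norm G)"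
proof -
  note u = tensor_square_measurable[OF in_L2_measurable[OF f]]
  note loc = tensor_square_integrable_on_cball[OF nonneg C2 f]
  note [measurable] = u sum_map_borel_measurable[OF C2]
  obtain F :: "_ \<Rightarrow> complex"
    where F [measurable]: "F \<in> borel_measurable borel"
      and repr_all: "\<forall>G. G \<in> borel_measurable borel \<longrightarrow>
        integrable lborel (\<lambda>p. G (sum_map \<phi> p) * tensor_square f p) \<longrightarrow>
        integrable lborel (\<lambda>q. G q * F q) \<and>
        (LINT q|lborel. G q * F q) = (LINT p|lborel. G (sum_map \<phi> p) * tensor_square f p)"
    using pushforward_integral[OF C2 conv u loc] by (elim exE conjE)
  note repr = repr_all[rule_format]
  have dens: "is_conv_density \<phi> f F"
    unfolding is_conv_density_def
  proof (intro conjI ballI impI)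
    fix A :: "((real^2) \<times> real) set" assume A [measurable]: "A \<in> sets borel" and "bounded A"
    then obtain r where r: "A \<subseteq> cball 0 r" using bounded_subset_ballD[OF \<open>bounded A\<close>, of 0] ball_subset_cball by blast
    have ind: "(\<lambda>q. indicator A q :: complex) \<in> borel_measurable borel" by measurable
    have int: "integrable lborel (\<lambda>p. indicator A (sum_map \<phi> p) * tensor_square f p)"
    proof (rule Bochner_Integration.integrable_bound[OF loc[of r]])
      show "AE p in lborel. norm (indicator A (sum_map \<phi> p) * tensor_square f p)
          \<le> norm (indicator (cball 0 r) (sum_map \<phi> p) *\<^sub>R tensor_square f p)"
        using r by (intro AE_I2) (auto simp: norm_mult indicator_def)
    qed measurable
    have scale: "indicator A q *\<^sub>R F q = indicator A q * F q" for q by (simp split: split_indicator)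
    show "set_integrable lborel A F"
      unfolding set_integrable_def scale using repr[OF ind int] by simp
    show "(LINT q:A|lborel. F q) = fsigma_conv \<phi> f A"
      unfolding set_lebesgue_integral_def scale fsigma_conv_eq[OF C2 f A int] using repr[OF ind int] by simp
  qed simp
  have bound: "(\<integral>\<^sup>+q. ennreal ((cmod (F q))\<^sup>2) \<partial>lborel) \<le> ennreal (pi / 2) * weighted_energy \<phi> f"
    unfolding weighted_energy_def by (rule weighted_L2_bound[OF C2 conv u loc F repr])
  also have "\<dots> \<le> ennreal (pi / 2) * ennreal ((L2_norm f) ^ 4)"
    by (intro mult_left_mono weighted_energy_le[OF C2 conv f]) simp
  also have "\<dots> < \<infinity>" by (simp flip: ennreal_mult)
  finally have F2: "in_L2 F" by (intro in_L2_I) simp_all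
  show ?thesis
  proof (intro exI[of _ "L2_norm F"] conjI allI impI)
    show "ennreal ((L2_norm F)\<^sup>2) \<le> ennreal (pi / 2) * weighted_energy \<phi> f"
      using bound by (simp add: nn_integral_L2_norm[OF F2])
    fix G :: "_ \<Rightarrow> complex" assume G: "in_L2 G" and int: "integrable lborel (\<lambda>p. G (sum_map \<phi> p) * tensor_square f p)"
    then show "cmod (LINT p|lborel. G (sum_map \<phi> p) * tensor_square f p) \<le> L2_norm F * L2_norm G"
      using repr[OF in_L2_measurable[OF G] int] L2_pairing_bound[OF F2 G] by simp
  qed (simp_all add: L2_norm_nonneg conv_norm_eq[OF dens F2])
qed

section \<open>Tangential exponentials\<close>

lemma nn_integral_exp_square:
  assumes "0 < c"
  shows "(\<integral>\<^sup>+t. ennreal (exp (- c * t\<^sup>2)) \<partial>lborel) = ennreal (sqrt (pi / c))"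
proof -
  \<comment> \<open>With this deviation the exponent of \<open>normal_density 0 \<sigma>\<close> is
    \<open>- c * t^2\<close>.\<close>
  define \<sigma> where "\<sigma> = sqrt (1 / (2 * c))"
  have \<sigma>: "0 < \<sigma>" "\<sigma>\<^sup>2 = 1 / (2 * c)" using assms by (simp_all add: \<sigma>_def)
  have "exp (- c * t\<^sup>2) = sqrt (pi / c) * normal_density 0 \<sigma> t" for t
    using assms by (simp add: normal_density_def \<sigma> real_sqrt_divide)
  then have "(\<integral>\<^sup>+t. ennreal (exp (- c * t\<^sup>2)) \<partial>lborel)
      = (\<integral>\<^sup>+t. ennreal (sqrt (pi / c)) * ennreal (normal_density 0 \<sigma> t) \<partial>lborel)"
    using assms by (simp add: ennreal_mult)
  also have "\<dots> = ennreal (sqrt (pi / c)) * (\<integral>\<^sup>+t. ennreal (normal_density 0 \<sigma> t) \<partial>lborel)"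
    by (rule nn_integral_cmult) simp
  also have "(\<integral>\<^sup>+t. ennreal (normal_density 0 \<sigma> t) \<partial>lborel) = 1"
    using \<sigma>(1) by (subst nn_integral_eq_integral) (auto simp: integrable_normal_density)
  finally show ?thesis by simp
qed

lemma nn_integral_gaussian:
  assumes "0 < c"
  shows "(\<integral>\<^sup>+w. ennreal (exp (- c * (norm (w :: real^2))\<^sup>2)) \<partial>lborel) = ennreal (pi / c)"
proof -
  have "exp (- c * (norm w)\<^sup>2) = (\<Prod>b\<in>Basis. exp (- c * (w \<bullet> b)\<^sup>2))" for w :: "real^2"
  proof -
    have "(norm w)\<^sup>2 = (\<Sum>b\<in>Basis. (w \<bullet> b)\<^sup>2)"
      unfolding power2_norm_eq_inner by (subst euclidean_inner) (simp add: power2_eq_square)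
    then show ?thesis by (simp add: sum_distrib_left exp_sum)
  qed
  then have "(\<integral>\<^sup>+w. ennreal (exp (- c * (norm (w :: real^2))\<^sup>2)) \<partial>lborel)
      = (\<integral>\<^sup>+w. (\<Prod>b\<in>Basis. ennreal (exp (- c * ((w :: real^2) \<bullet> b)\<^sup>2))) \<partial>lborel)"
    by (simp add: prod_ennreal)
  also have "\<dots> = (\<Prod>b\<in>(Basis :: (real^2) set). \<integral>\<^sup>+t. ennreal (exp (- c * t\<^sup>2)) \<partial>lborel)"
    by (rule nn_integral_lborel_prod) auto
  also have "\<dots> = ennreal (sqrt (pi / c)) * ennreal (sqrt (pi / c))"
    by (simp add: nn_integral_exp_square[OF assms, simplified] Basis_real2 axis_real2_neq)
  also have "\<dots> = ennreal (pi / c)" using assms by (simp flip: ennreal_mult real_sqrt_mult)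
  finally show ?thesis .
qed

lemma nn_integral_gaussian_shifted:
  assumes "0 < c"
  shows "(\<integral>\<^sup>+y. ennreal (exp (- c * (norm (- z + y :: real^2))\<^sup>2)) \<partial>lborel) = ennreal (pi / c)"
proof -
  have "(\<lambda>w :: real^2. ennreal (exp (- c * (norm w)\<^sup>2))) \<in> borel_measurable borel" by measurable
  from nn_integral_lborel_translate[OF this, of "- z"] nn_integral_gaussian[OF assms]
  show ?thesis by simp
qed

lemma nn_integral_exp_tail:
  assumes "0 < c"
  shows "(\<integral>\<^sup>+t. ennreal (exp (- c * t)) * indicator {r..} t \<partial>lborel) = ennreal (exp (- c * r) / c)"
proof -
  have "((\<lambda>t. exp (- c * t)) \<longlongrightarrow> 0) at_top"
    using assms
    by (intro filterlim_compose[OF exp_at_bot] filterlim_tendsto_neg_mult_at_bot[OF tendsto_const]) (auto simp: filterlim_ident)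
  from tendsto_divide[OF tendsto_minus[OF this] tendsto_const[of c]] assms
  have lim: "((\<lambda>t. - exp (- c * t) / c) \<longlongrightarrow> 0) at_top" by simp
  have "(\<integral>\<^sup>+t. ennreal (exp (- c * t)) * indicator {r..} t \<partial>lborel) = ennreal (0 - (- exp (- c * r) / c))"
    by (rule nn_integral_FTC_atLeast[OF _ _ _ lim])
       (use assms in \<open>auto intro!: derivative_eq_intros simp: field_simps\<close>)
  then show ?thesis by simp
qed

section \<open>Mass and convolution norm of tangential exponentials\<close>

context
  fixes \<phi> :: "real^2 \<Rightarrow> real"
  assumes nonneg: "\<And>y. 0 \<le> \<phi> y" and C2: "C2 \<phi>" and conv: "strictly_convex \<phi>"
begin

lemma tangent_gap_measurable [measurable]: "tangent_gap \<phi> z \<in> borel_measurable borel"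
proof -
  note [measurable] = psi_borel_measurable[OF C2]
  show ?thesis unfolding tangent_gap_def[abs_def] by measurable
qed

lemma tangent_exp_measurable [measurable]: "tangent_exp \<phi> a z \<in> borel_measurable borel"
  unfolding tangent_exp_eq[abs_def] by measurable

lemma tangent_exp_square: "(cmod (tangent_exp \<phi> a z y))\<^sup>2 = exp (- (2 * a) * tangent_gap \<phi> z y)"
  by (simp add: tangent_exp_eq power2_eq_square flip: exp_add)

text \<open>By \<open>tangent_gap_ge\<close> the squared modulus lies below a Gaussian centred at
  \<open>z\<close>.\<close>

lemma in_L2_tangent_exp:
  assumes "0 < a"
  shows "in_L2 (tangent_exp \<phi> a z)"
proof (rule in_L2_I)
  have "(\<integral>\<^sup>+y. ennreal ((cmod (tangent_exp \<phi> a z y))\<^sup>2) \<partial>lborel)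
      \<le> (\<integral>\<^sup>+y. ennreal (exp (- (2 * a) * (norm (- z + y))\<^sup>2)) \<partial>lborel)"
    unfolding tangent_exp_square
    using tangent_gap_ge[OF C2 conv, of _ z] assms by (intro nn_integral_mono ennreal_leI) simp
  also have "\<dots> = ennreal (pi / (2 * a))"
    using assms by (intro nn_integral_gaussian_shifted) simp
  finally show "(\<integral>\<^sup>+y. ennreal ((cmod (tangent_exp \<phi> a z y))\<^sup>2) \<partial>lborel) < \<infinity>"
    by (rule le_less_trans) simp
qed measurable

lemma L2_norm_tangent_exp_pos:
  assumes "0 < a"
  shows "0 < L2_norm (tangent_exp \<phi> a z)"
proof (rule ccontr)
  assume "\<not> ?thesis"
  then have "L2_norm (tangent_exp \<phi> a z) = 0" using L2_norm_nonneg[of "tangent_exp \<phi> a z"] by simp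
  then have "(\<integral>\<^sup>+y. ennreal ((cmod (tangent_exp \<phi> a z y))\<^sup>2) \<partial>lborel) = 0"
    by (simp add: nn_integral_L2_norm[OF in_L2_tangent_exp[OF assms]])
  then have "AE y in (lborel :: (real^2) measure). False"
    unfolding tangent_exp_square by (subst (asm) nn_integral_0_iff_AE) auto
  then show False by (subst (asm) AE_iff_measurable[OF _ refl]) auto
qed

lemma L2_normalize_tangent_exp:
  assumes "0 < a"
  shows "in_L2 (L2_normalize (tangent_exp \<phi> a z))" "L2_norm (L2_normalize (tangent_exp \<phi> a z)) = 1"
proof -
  let ?T = "tangent_exp \<phi> a z"
  have eq: "(cmod (L2_normalize ?T y))\<^sup>2 = (cmod (?T y))\<^sup>2 / (L2_norm ?T)\<^sup>2" for y
    by (simp add: L2_normalize_def norm_divide power_divide)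
  show "in_L2 (L2_normalize ?T)"
    using in_L2_tangent_exp[OF assms, of z] unfolding in_L2_def eq
    by (auto simp: L2_normalize_def[abs_def])
  have "L2_norm (L2_normalize ?T) = sqrt ((LINT y|lborel. (cmod (?T y))\<^sup>2) / (L2_norm ?T)\<^sup>2)"
    by (simp add: L2_norm_def[of "L2_normalize ?T"] eq)
  also have "(LINT y|lborel. (cmod (?T y))\<^sup>2) = (L2_norm ?T)\<^sup>2"
    by (simp add: L2_norm_def integral_nonneg_AE)
  finally show "L2_norm (L2_normalize ?T) = 1"
    using L2_norm_tangent_exp_pos[OF assms, of z] by simp
qed

text \<open>Laplace's method: near \<open>z\<close> the squared exponential dominates a slightly
  narrower Gaussian, and the part of that Gaussian away from \<open>z\<close> is exponentially small
  in \<open>a\<close>.\<close>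

lemma tangent_exp_mass:
  assumes "0 < \<epsilon>" and hess: "\<And>v. norm (hessian \<phi> z *v v) \<le> \<epsilon> * norm v"
  shows "\<forall>\<^sub>F a in at_top. pi / (2 * (1 + 3 * \<epsilon>)) < a * (L2_norm (tangent_exp \<phi> a z))\<^sup>2"
proof -
  \<comment> \<open>One \<open>\<epsilon>\<close> comes from the Hessian and one from the
    differentiability error. The third \<open>\<epsilon>\<close> in the claim is slack that absorbs
    the exponentially small term.\<close>
  let ?c = "1 + 2 * \<epsilon>"
  obtain \<delta> where \<delta>: "\<delta> > 0" "\<And>y. norm (y - z) < \<delta> \<Longrightarrow> tangent_gap \<phi> z y \<le> ?c * (norm (y - z))\<^sup>2"
    using tangent_gap_upper[OF C2 conv hess \<open>0 < \<epsilon>\<close>] by (auto simp: algebra_simps)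
  have lower: "pi / (2 * ?c) - exp (- (?c * \<delta>\<^sup>2) * a) * (pi / ?c) \<le> a * (L2_norm (tangent_exp \<phi> a z))\<^sup>2"
    if a: "0 < a" for a
  proof -
    let ?N2 = "(L2_norm (tangent_exp \<phi> a z))\<^sup>2" and ?q = "exp (- (?c * \<delta>\<^sup>2) * a)"
    have "ennreal (pi / (2 * a * ?c)) = (\<integral>\<^sup>+y. ennreal (exp (- (2 * a * ?c) * (norm (- z + y))\<^sup>2)) \<partial>lborel)"
      using a \<open>0 < \<epsilon>\<close> by (intro nn_integral_gaussian_shifted[symmetric]) simp
    also have "\<dots> \<le> (\<integral>\<^sup>+y. ennreal ((cmod (tangent_exp \<phi> a z y))\<^sup>2)
        + ennreal ?q * ennreal (exp (- (a * ?c) * (norm (- z + y))\<^sup>2)) \<partial>lborel)"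
    proof (rule nn_integral_mono)
      fix y
      let ?r = "norm (- z + y)"
      have "exp (- (2 * a * ?c) * ?r\<^sup>2) \<le> (cmod (tangent_exp \<phi> a z y))\<^sup>2 + ?q * exp (- (a * ?c) * ?r\<^sup>2)"
      proof (cases "?r < \<delta>")
        case True
        then have "exp (- (2 * a * ?c) * ?r\<^sup>2) \<le> (cmod (tangent_exp \<phi> a z y))\<^sup>2"
          using \<delta>(2)[of y] a by (simp add: tangent_exp_square)
        then show ?thesis by (simp add: add_increasing2)
      next
        case False
        then have "\<delta>\<^sup>2 \<le> ?r\<^sup>2" using \<delta>(1) by (simp add: power_mono)
        \<comment> \<open>Outside the ball half of the Gaussian exponent pays for the factor
          \<open>?q\<close>; the other half is kept for integrability.\<close>
        then have "a * ?c * \<delta>\<^sup>2 \<le> a * ?c * ?r\<^sup>2"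
          using a \<open>0 < \<epsilon>\<close> by (intro mult_left_mono) auto
        then have "exp (- (2 * a * ?c) * ?r\<^sup>2) \<le> exp (- (?c * \<delta>\<^sup>2) * a + - (a * ?c) * ?r\<^sup>2)"
          by (simp add: algebra_simps)
        also have "\<dots> = ?q * exp (- (a * ?c) * ?r\<^sup>2)" by (rule exp_add)
        finally show ?thesis by (rule add_increasing[rotated]) simp
      qed
      then show "ennreal (exp (- (2 * a * ?c) * ?r\<^sup>2))
          \<le> ennreal ((cmod (tangent_exp \<phi> a z y))\<^sup>2) + ennreal ?q * ennreal (exp (- (a * ?c) * ?r\<^sup>2))"
        by (simp add: ennreal_leI flip: ennreal_mult ennreal_plus)
    qed
    also have "\<dots> = ennreal ?N2 + ennreal ?q * (\<integral>\<^sup>+y. ennreal (exp (- (a * ?c) * (norm (- z + y))\<^sup>2)) \<partial>lborel)"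
      by (subst nn_integral_add, measurable)
         (subst nn_integral_cmult, measurable, simp only: nn_integral_L2_norm[OF in_L2_tangent_exp[OF a]])
    also have "(\<integral>\<^sup>+y. ennreal (exp (- (a * ?c) * (norm (- z + y))\<^sup>2)) \<partial>lborel) = ennreal (pi / (a * ?c))"
      using a \<open>0 < \<epsilon>\<close> by (intro nn_integral_gaussian_shifted) simp
    also have "ennreal ?N2 + ennreal ?q * ennreal (pi / (a * ?c)) = ennreal (?N2 + ?q * (pi / (a * ?c)))"
      using a \<open>0 < \<epsilon>\<close> by (simp flip: ennreal_mult ennreal_plus)
    finally have "pi / (2 * a * ?c) \<le> ?N2 + ?q * (pi / (a * ?c))"
      using a \<open>0 < \<epsilon>\<close> by (subst (asm) ennreal_le_iff) auto
    then have le: "a * (pi / (2 * a * ?c)) \<le> a * (?N2 + ?q * (pi / (a * ?c)))"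
      using a by (intro mult_left_mono) auto
    have cancel: "a * (pi / (2 * a * ?c)) = pi / (2 * ?c)" "a * (pi / (a * ?c)) = pi / ?c"
      using a by (simp_all only: mult.commute[of 2 a] mult.assoc times_divide_eq_right) simp_all
    have distrib: "a * (?N2 + ?q * (pi / (a * ?c))) = a * ?N2 + ?q * (a * (pi / (a * ?c)))"
      by (simp only: distrib_left mult.left_commute)
    show ?thesis using le unfolding distrib cancel by (simp only: diff_le_eq)
  qed
  have "((\<lambda>a. exp (- (?c * \<delta>\<^sup>2) * a)) \<longlongrightarrow> 0) at_top"
    using \<delta>(1) \<open>0 < \<epsilon>\<close>
    by (intro filterlim_compose[OF exp_at_bot] filterlim_tendsto_neg_mult_at_bot[OF tendsto_const])
       (auto simp: filterlim_ident add_pos_pos)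
  then have "((\<lambda>a. pi / (2 * ?c) - exp (- (?c * \<delta>\<^sup>2) * a) * (pi / ?c)) \<longlongrightarrow> pi / (2 * ?c) - 0 * (pi / ?c)) at_top"
    by (intro tendsto_intros)
  moreover have "pi / (2 * (1 + 3 * \<epsilon>)) < pi / (2 * ?c) - 0 * (pi / ?c)"
    using \<open>0 < \<epsilon>\<close> by (simp add: divide_strict_left_mono)
  ultimately have "\<forall>\<^sub>F a in at_top. pi / (2 * (1 + 3 * \<epsilon>)) < pi / (2 * ?c) - exp (- (?c * \<delta>\<^sup>2) * a) * (pi / ?c)"
    by (rule order_tendstoD)
  then show ?thesis
    using eventually_gt_at_top[of 0]
    by eventually_elim (use lower in \<open>auto intro: less_le_trans\<close>)
qed

text \<open>The pairing inequality is tested with a \<open>G\<close> for which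
  \<open>G (sum_map \<phi> p)\<close> is \<open>N^2\<close> times the tensor square. The pairing is
  then \<open>N^2\<close>, while \<open>L2_norm G\<close> is \<open>sqrt (pi / 2) / a\<close> by an
  exact Gaussian computation.\<close>

lemma conv_norm_tangent_exp_ge:
  assumes a: "0 < a"
  shows "ereal (a * (L2_norm (tangent_exp \<phi> a z))\<^sup>2 / sqrt (pi / 2))
    \<le> conv_norm \<phi> (L2_normalize (tangent_exp \<phi> a z))"
proof -
  let ?T = "tangent_exp \<phi> a z"
  define N where "N = L2_norm ?T"
  have N: "0 < N" using L2_norm_tangent_exp_pos[OF a] by (simp add: N_def)
  define f where "f = L2_normalize ?T"
  have f: "in_L2 f" "L2_norm f = 1" using L2_normalize_tangent_exp[OF a] by (simp_all add: f_def)
  obtain c where c: "c \<ge> 0" "conv_norm \<phi> f = ereal c" and pairing: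
    "\<And>G. in_L2 G \<Longrightarrow> integrable lborel (\<lambda>p. G (sum_map \<phi> p) * tensor_square f p) \<Longrightarrow>
      cmod (LINT p|lborel. G (sum_map \<phi> p) * tensor_square f p) \<le> c * L2_norm G"
    using conv_norm_characterization[OF nonneg C2 conv f(1)] by blast
  \<comment> \<open>At \<open>x + y\<close> this is the sum of the values at \<open>x\<close> and
    \<open>y\<close> of the affine tangent function at \<open>z\<close>, so on the range of
    \<open>sum_map\<close> the height above \<open>h\<close> is the sum of two tangent gaps.\<close>
  define h where "h \<xi> = 2 * psi \<phi> z + gradient (psi \<phi>) z \<bullet> (\<xi> - 2 *\<^sub>R z)" for \<xi>
  \<comment> \<open>By the parallelogram law \<open>r (x + y)\<close> is at most the sum of the
    squared distances of \<open>x\<close> and \<open>y\<close> from \<open>z\<close>, hence at most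
    the sum of their gaps. The region \<open>r \<le> t - h\<close> thus contains the range of
    \<open>sum_map\<close>, and cutting off to it makes \<open>G\<close> square integrable.\<close>
  define r where "r \<xi> = (norm (- (2 *\<^sub>R z) + \<xi>))\<^sup>2 / 2" for \<xi> :: "real^2"
  define G :: "(real^2) \<times> real \<Rightarrow> complex" where "G q = of_real (exp (- a * (snd q - h (fst q)))) * indicator {q. r (fst q) \<le> snd q - h (fst q)} q"
    for q
  have [measurable]: "h \<in> borel_measurable borel" "r \<in> borel_measurable borel"
    unfolding h_def[abs_def] r_def[abs_def] by measurable
  have G_meas: "G \<in> borel_measurable borel"
    unfolding G_def[abs_def] borel_prod[symmetric] by measurable
  have G_int: "(\<integral>\<^sup>+q. ennreal ((cmod (G q))\<^sup>2) \<partial>lborel) = ennreal (pi / (2 * a\<^sup>2))"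
  proof -
    have G_sq: "ennreal ((cmod (G (\<xi>, h \<xi> + \<theta>)))\<^sup>2) = ennreal (exp (- (2 * a) * \<theta>)) * indicator {r \<xi>..} \<theta>" for \<xi> \<theta>
      by (auto simp: G_def norm_mult power2_eq_square split: split_indicator simp flip: exp_add)
    have [measurable]: "G \<in> borel_measurable (borel \<Otimes>\<^sub>M borel)" unfolding borel_prod by (rule G_meas)
    have "(\<integral>\<^sup>+q. ennreal ((cmod (G q))\<^sup>2) \<partial>lborel) = (\<integral>\<^sup>+\<xi>. \<integral>\<^sup>+\<tau>. ennreal ((cmod (G (\<xi>, \<tau>)))\<^sup>2) \<partial>lborel \<partial>lborel)"
      unfolding lborel_prod[symmetric] by (subst lborel.nn_integral_fst[symmetric]) simp_all
    also have "\<dots> = (\<integral>\<^sup>+\<xi>. \<integral>\<^sup>+\<theta>. ennreal ((cmod (G (\<xi>, h \<xi> + \<theta>)))\<^sup>2) \<partial>lborel \<partial>lborel)"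
      by (intro nn_integral_cong nn_integral_lborel_translate[symmetric]) measurable
    also have "\<dots> = (\<integral>\<^sup>+\<xi>. ennreal (1 / (2 * a)) * ennreal (exp (- a * (norm (- (2 *\<^sub>R z) + \<xi>))\<^sup>2)) \<partial>lborel)"
    proof (rule nn_integral_cong)
      fix \<xi>
      show "(\<integral>\<^sup>+\<theta>. ennreal ((cmod (G (\<xi>, h \<xi> + \<theta>)))\<^sup>2) \<partial>lborel)
          = ennreal (1 / (2 * a)) * ennreal (exp (- a * (norm (- (2 *\<^sub>R z) + \<xi>))\<^sup>2))"
        unfolding G_sq using a by (subst nn_integral_exp_tail) (simp_all add: r_def flip: ennreal_mult)
    qed
    also have "\<dots> = ennreal (1 / (2 * a)) * ennreal (pi / a)"
      by (subst nn_integral_cmult, measurable) (simp only: nn_integral_gaussian_shifted[OF a])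
    also have "\<dots> = ennreal (pi / (2 * a\<^sup>2))"
      using a by (simp add: power2_eq_square flip: ennreal_mult)
    finally show ?thesis .
  qed
  have G_L2: "in_L2 G" using G_meas G_int by (intro in_L2_I) auto
  have G_norm: "L2_norm G = sqrt (pi / 2) / a"
  proof -
    have "ennreal ((L2_norm G)\<^sup>2) = ennreal (pi / (2 * a\<^sup>2))"
      using nn_integral_L2_norm[OF G_L2] G_int by simp
    then have "(L2_norm G)\<^sup>2 = (sqrt (pi / 2) / a)\<^sup>2"
      using a by (simp add: power_divide)
    then show ?thesis using a L2_norm_nonneg[of G] by (simp add: power2_eq_iff_nonneg)
  qed
  \<comment> \<open>Both factors are real multiples of the same exponential, as the cutoff equals 1
    on the range of \<open>sum_map\<close>; the normalization of \<open>f\<close> leaves the factor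
    \<open>N^2\<close>.\<close>
  have GS: "G (sum_map \<phi> p) * tensor_square f p = of_real (N\<^sup>2 * (cmod (tensor_square f p))\<^sup>2)" for p
  proof -
    obtain x y where p: "p = (x, y)" by (cases p)
    let ?g = "tangent_gap \<phi> z"
    have \<theta>: "psi \<phi> x + psi \<phi> y - h (x + y) = ?g x + ?g y"
      by (simp add: h_def tangent_gap_def inner_diff_right inner_add_right algebra_simps)
    have "(norm (x - z))\<^sup>2 + (norm (y - z))\<^sup>2 - r (x + y) = (norm (x - y))\<^sup>2 / 2"
      by (simp add: r_def power2_norm_eq_inner inner_diff_left inner_diff_right inner_add_left inner_add_right
          inner_commute field_simps)
    then have "r (x + y) \<le> (norm (x - z))\<^sup>2 + (norm (y - z))\<^sup>2"
      using zero_le_power2[of "norm (x - y)"] by linarith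
    also have "\<dots> \<le> ?g x + ?g y" by (intro add_mono tangent_gap_ge[OF C2 conv])
    finally have "G (sum_map \<phi> p) = of_real (exp (- a * (?g x + ?g y)))"
      by (simp add: p G_def sum_map_def \<theta>)
    moreover have "tensor_square f p = of_real (exp (- a * (?g x + ?g y)) / N\<^sup>2)"
      by (simp add: p tensor_square_def f_def L2_normalize_def tangent_exp_eq N_def power2_eq_square distrib_left
          flip: of_real_mult exp_add)
    ultimately show ?thesis using N by (simp add: power2_eq_square norm_mult norm_divide)
  qed
  have int: "integrable lborel (\<lambda>p. (cmod (tensor_square f p))\<^sup>2)"
  proof (rule integrableI_bounded)
    show "(\<integral>\<^sup>+p. ennreal (norm ((cmod (tensor_square f p))\<^sup>2)) \<partial>lborel) < \<infinity>"
      using nn_integral_tensor_square[OF f(1)] by simp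
  qed (use tensor_square_measurable[OF in_L2_measurable[OF f(1)]] in measurable)
  have "ennreal (LINT p|lborel. (cmod (tensor_square f p))\<^sup>2) = ennreal 1"
    using nn_integral_tensor_square[OF f(1)] f(2) by (subst nn_integral_eq_integral[OF int, symmetric]) auto
  then have one: "(LINT p|lborel. (cmod (tensor_square f p))\<^sup>2) = 1"
    by (subst (asm) ennreal_inj) (auto intro: integral_nonneg_AE)
  have "(LINT p|lborel. G (sum_map \<phi> p) * tensor_square f p) = of_real (N\<^sup>2)"
    unfolding GS integral_complex_of_real using one by simp
  moreover have "integrable lborel (\<lambda>p. G (sum_map \<phi> p) * tensor_square f p)"
    unfolding GS complex_of_real_integrable_eq using int by simp
  ultimately have "cmod (of_real (N\<^sup>2)) \<le> c * (sqrt (pi / 2) / a)"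
    using pairing[OF G_L2] G_norm by simp
  then have "a * N\<^sup>2 / sqrt (pi / 2) \<le> c"
    using a by (simp add: norm_power field_simps)
  then show ?thesis using c(2) by (simp add: f_def N_def)
qed

end

section \<open>The sharp constant\<close>

text \<open>Cauchy-Schwarz row by row, with \<open>norm A\<close> the Frobenius norm. It turns
  convergence of the Hessians into the operator bound that \<open>tangent_exp_mass\<close> asks
  for.\<close>

lemma norm_matrix_vector_mult_le:
  fixes A :: "real^'n^'m"
  shows "norm (A *v x) \<le> norm A * norm x"
proof -
  have "norm (A *v x) \<le> L2_set (\<lambda>i. norm (A $ i) * norm x) UNIV"
    unfolding norm_vec_def[of "A *v x"]
    by (intro L2_set_mono) (simp_all add: matrix_mult_dot Cauchy_Schwarz_ineq2)
  also have "\<dots> = norm A * norm x"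
    by (simp add: norm_vec_def[of A] L2_set_left_distrib)
  finally show ?thesis .
qed

text \<open>Square roots of the energy estimates, weak and strict. The last claim lets later
  arguments work with real numbers instead of \<open>ereal\<close>.\<close>

lemma conv_norm_le:
  assumes nonneg: "\<And>y. 0 \<le> \<phi> y" and C2: "C2 \<phi>" and conv: "strictly_convex \<phi>" and f: "in_L2 f"
  shows "conv_norm \<phi> f \<le> ereal (sqrt (pi / 2) * (L2_norm f)\<^sup>2)"
    and "nonzero_L2 f \<Longrightarrow> conv_norm \<phi> f < ereal (sqrt (pi / 2) * (L2_norm f)\<^sup>2)"
    and "\<exists>c\<ge>0. conv_norm \<phi> f = ereal c"
proof -
  obtain c where c: "c \<ge> 0" "conv_norm \<phi> f = ereal c"
    and le: "ennreal (c\<^sup>2) \<le> ennreal (pi / 2) * weighted_energy \<phi> f"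
    using conv_norm_characterization[OF nonneg C2 conv f] by blast
  let ?b = "sqrt (pi / 2) * (L2_norm f)\<^sup>2"
  have b: "ennreal (pi / 2) * ennreal ((L2_norm f) ^ 4) = ennreal (?b\<^sup>2)"
    by (simp add: power_mult_distrib flip: ennreal_mult power_mult)
  have "ennreal (c\<^sup>2) \<le> ennreal (?b\<^sup>2)"
    unfolding b[symmetric] by (rule order_trans[OF le]) (intro mult_left_mono weighted_energy_le[OF C2 conv f]; simp)
  then have "c\<^sup>2 \<le> ?b\<^sup>2" by (subst (asm) ennreal_le_iff) auto
  then have "c \<le> ?b" by (rule power2_le_imp_le) simp
  then show "conv_norm \<phi> f \<le> ereal ?b" using c by simp
  show "conv_norm \<phi> f < ereal ?b" if "nonzero_L2 f"
  proof -
    have "ennreal (c\<^sup>2) < ennreal (?b\<^sup>2)"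
      unfolding b[symmetric]
      by (rule le_less_trans[OF le])
         (intro ennreal_mult_strict_left_mono weighted_energy_less[OF C2 conv that]; simp)
    then have "c\<^sup>2 < ?b\<^sup>2" by (subst (asm) ennreal_less_iff) auto
    then have "c < ?b" by (rule power_less_imp_less_base) simp
    then show ?thesis using c by simp
  qed
  show "\<exists>c\<ge>0. conv_norm \<phi> f = ereal c" using c by blast
qed

text \<open>The norms are at most \<open>sqrt (pi / 2)\<close> by the sharp inequality. The mass
  hypothesis bounds them from below, eventually for each \<open>\<epsilon>\<close>, by a quantity
  that tends to \<open>(pi / 2) / sqrt (pi / 2)\<close>, the same value, as
  \<open>\<epsilon>\<close> tends to 0.\<close>

lemma conv_norm_tangent_exp_tendsto:
  assumes nonneg: "\<And>y. 0 \<le> \<phi> y" and C2: "C2 \<phi>" and conv: "strictly_convex \<phi>"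
    and a: "\<And>n. 0 < a n"
    and mass: "\<And>\<epsilon>. 0 < \<epsilon> \<Longrightarrow> \<forall>\<^sub>F n in sequentially.
      pi / (2 * (1 + 3 * \<epsilon>)) < a n * (L2_norm (tangent_exp \<phi> (a n) (z n)))\<^sup>2"
  shows "(\<lambda>n. conv_norm \<phi> (L2_normalize (tangent_exp \<phi> (a n) (z n)))) \<longlonglongrightarrow> ereal (sqrt (pi / 2))"
proof -
  let ?f = "\<lambda>n. L2_normalize (tangent_exp \<phi> (a n) (z n))"
  define c where "c n = real_of_ereal (conv_norm \<phi> (?f n))" for n
  note f = L2_normalize_tangent_exp[OF nonneg C2 conv a]
  have c: "conv_norm \<phi> (?f n) = ereal (c n)" for n
    using conv_norm_le(3)[OF nonneg C2 conv f(1), of n "z n"] unfolding c_def by force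
  have upper: "c n \<le> sqrt (pi / 2)" for n
    using conv_norm_le(1)[OF nonneg C2 conv f(1), of n "z n"] by (simp add: c f(2))
  have lower: "\<forall>\<^sub>F n in sequentially. l < c n" if "l < sqrt (pi / 2)" for l
  proof -
    let ?g = "\<lambda>\<epsilon>. (pi / (2 * (1 + 3 * \<epsilon>))) / sqrt (pi / 2)"
    have "(?g \<longlongrightarrow> (pi / (2 * (1 + 3 * 0))) / sqrt (pi / 2)) (at_right 0)"
      by (intro tendsto_intros) auto
    moreover have "(pi / (2 * (1 + 3 * 0))) / sqrt (pi / 2) = sqrt (pi / 2)"
      using real_div_sqrt[of "pi / 2"] by simp
    ultimately have "\<forall>\<^sub>F \<epsilon> in at_right 0. l < ?g \<epsilon>"
      using that by (auto intro: order_tendstoD)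
    then have "\<forall>\<^sub>F \<epsilon> in at_right 0. l < ?g \<epsilon> \<and> 0 < \<epsilon>"
      by (intro eventually_conj eventually_at_right_less)
    then obtain \<epsilon> where \<epsilon>: "l < ?g \<epsilon>" "0 < \<epsilon>"
      using eventually_happens'[OF trivial_limit_at_right_real] by blast
    from mass[OF \<epsilon>(2)] show ?thesis
    proof eventually_elim
      case (elim n)
      have "a n * (L2_norm (tangent_exp \<phi> (a n) (z n)))\<^sup>2 / sqrt (pi / 2) \<le> c n"
        using conv_norm_tangent_exp_ge[OF nonneg C2 conv a, of n "z n"] by (simp add: c)
      moreover have "?g \<epsilon> < a n * (L2_norm (tangent_exp \<phi> (a n) (z n)))\<^sup>2 / sqrt (pi / 2)"
        using elim by (intro divide_strict_right_mono) auto
      ultimately show ?case using \<epsilon>(1) by linarith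
    qed
  qed
  have "c \<longlonglongrightarrow> sqrt (pi / 2)"
  proof (rule order_tendstoI)
    fix r assume "sqrt (pi / 2) < r"
    then show "\<forall>\<^sub>F n in sequentially. c n < r"
      using upper by (intro always_eventually allI) (rule le_less_trans)
  qed (rule lower)
  then show ?thesis unfolding c by simp
qed

text \<open>In case (i) the parameter is \<open>Suc n\<close> because parameter 0 would give the
  constant function 1, which is not square integrable.\<close>

theorem theorem1p2:
  fixes \<phi> :: "real^2 \<Rightarrow> real"
  assumes nonneg: "\<And>y. \<phi> y \<ge> 0"
    and smooth: "C2 \<phi>"
    and convex: "strictly_convex \<phi>"
    and hess: "(\<exists>y0. hessian_vanishes_at \<phi> y0) \<or> (\<exists>y. hessian_vanishes_along \<phi> y)"
  shows "(\<forall>f. in_L2 f \<longrightarrow> conv_norm \<phi> f \<le> (opt_const \<phi>)\<^sup>2 * ereal ((L2_norm f)\<^sup>2))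
    \<and> opt_const \<phi> = ereal ((pi / 2) powr (1 / 4))
    \<and> (\<forall>y0. hessian_vanishes_at \<phi> y0 \<longrightarrow>
         extremizing_seq \<phi> (\<lambda>n. L2_normalize (tangent_exp \<phi> (real (Suc n)) y0)))
    \<and> (\<forall>y. hessian_vanishes_along \<phi> y \<longrightarrow>
         (\<exists>a. (\<forall>n. a n > 0) \<and>
            extremizing_seq \<phi> (\<lambda>n. L2_normalize (tangent_exp \<phi> (a n) (y n)))))
    \<and> \<not> (\<exists>f. extremizer \<phi> f)"
proof -
  note ctx = nonneg smooth convex
  let ?K = "(pi / 2) powr (1 / 4)"
  have K2: "?K\<^sup>2 = sqrt (pi / 2)"
    by (simp add: powr_powr powr_half_sqrt flip: powr_numeral)
  have sqrtK: "sqrt (sqrt (pi / 2)) = ?K"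
    unfolding K2[symmetric] by simp
  have case_i: "\<And>n. 0 < real (Suc n)"
    "(\<lambda>n. conv_norm \<phi> (L2_normalize (tangent_exp \<phi> (real (Suc n)) y0))) \<longlonglongrightarrow> ereal (sqrt (pi / 2))"
    if "hessian_vanishes_at \<phi> y0" for y0
  proof -
    have "\<forall>\<^sub>F n in sequentially.
        pi / (2 * (1 + 3 * \<epsilon>)) < real (Suc n) * (L2_norm (tangent_exp \<phi> (real (Suc n)) y0))\<^sup>2"
      if "0 < \<epsilon>" for \<epsilon>
    proof -
      have lim: "filterlim (\<lambda>n. real (Suc n)) at_top sequentially"
        by (rule filterlim_compose[OF filterlim_real_sequentially filterlim_Suc])
      have "norm (hessian \<phi> y0 *v v) \<le> \<epsilon> * norm v" for v
        using \<open>hessian_vanishes_at \<phi> y0\<close> that by (simp add: hessian_vanishes_at_def)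
      from filterlim_iff[THEN iffD1, OF lim, rule_format, OF tangent_exp_mass[OF ctx that this]]
      show ?thesis .
    qed
    then show "(\<lambda>n. conv_norm \<phi> (L2_normalize (tangent_exp \<phi> (real (Suc n)) y0))) \<longlonglongrightarrow> ereal (sqrt (pi / 2))"
      by (intro conv_norm_tangent_exp_tendsto[OF ctx]) simp_all
  qed simp
  have case_ii: "\<exists>a. (\<forall>n. 0 < a n) \<and>
      (\<lambda>n. conv_norm \<phi> (L2_normalize (tangent_exp \<phi> (a n) (y n)))) \<longlonglongrightarrow> ereal (sqrt (pi / 2))"
    if y: "hessian_vanishes_along \<phi> y" for y
  proof -
    \<comment> \<open>The summand \<open>1 / real (Suc n)\<close> keeps \<open>e n\<close> positive
      even where the Hessian vanishes, and it tends to 0.\<close>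
    define e where "e n = norm (hessian \<phi> (y n)) + 1 / real (Suc n)" for n
    have e_pos: "0 < e n" for n by (simp add: e_def add_nonneg_pos)
    have "(\<lambda>n. norm (hessian \<phi> (y n)) + 1 / real (Suc n)) \<longlonglongrightarrow> 0 + 0"
      using y unfolding hessian_vanishes_along_def
      by (intro tendsto_add tendsto_norm_zero LIMSEQ_Suc[OF lim_1_over_n]) simp
    then have e_lim: "e \<longlonglongrightarrow> 0" by (simp add: e_def[abs_def])
    \<comment> \<open>The parameter is chosen separately for each \<open>n\<close>, large enough for
      the accuracy \<open>e n\<close> at the point \<open>y n\<close>; these choices form the
      sequence of case (ii).\<close>
    have "\<exists>a>0. pi / (2 * (1 + 3 * e n)) < a * (L2_norm (tangent_exp \<phi> a (y n)))\<^sup>2" for n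
    proof -
      have "norm (hessian \<phi> (y n) *v v) \<le> e n * norm v" for v
        by (rule order_trans[OF norm_matrix_vector_mult_le]) (simp add: e_def mult_right_mono)
      from tangent_exp_mass[OF ctx e_pos this] eventually_gt_at_top[of 0]
      have "\<forall>\<^sub>F a in at_top. 0 < a \<and> pi / (2 * (1 + 3 * e n)) < a * (L2_norm (tangent_exp \<phi> a (y n)))\<^sup>2"
        by eventually_elim auto
      then show ?thesis using eventually_happens'[OF trivial_limit_at_top_linorder] by blast
    qed
    then obtain a where a: "\<And>n. 0 < a n"
      "\<And>n. pi / (2 * (1 + 3 * e n)) < a n * (L2_norm (tangent_exp \<phi> (a n) (y n)))\<^sup>2" by metis
    have "\<forall>\<^sub>F n in sequentially. pi / (2 * (1 + 3 * \<epsilon>)) < a n * (L2_norm (tangent_exp \<phi> (a n) (y n)))\<^sup>2"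
      if "0 < \<epsilon>" for \<epsilon>
      using order_tendstoD(2)[OF e_lim that]
    proof eventually_elim
      case (elim n)
      have "pi / (2 * (1 + 3 * \<epsilon>)) \<le> pi / (2 * (1 + 3 * e n))"
        using elim e_pos[of n] by (intro divide_left_mono) auto
      then show ?case using a(2)[of n] by linarith
    qed
    with a(1) show ?thesis by (blast intro: conv_norm_tangent_exp_tendsto[OF ctx])
  qed
  \<comment> \<open>Either case supplies one sequence whose norms approach
    \<open>sqrt (pi / 2)\<close>, which is all the lower bound for \<open>opt_const\<close> asks
    for.\<close>
  obtain a z where a: "\<And>n. 0 < a n"
    and lim: "(\<lambda>n. conv_norm \<phi> (L2_normalize (tangent_exp \<phi> (a n) (z n)))) \<longlonglongrightarrow> ereal (sqrt (pi / 2))"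
  proof -
    from hess show thesis
    proof
      assume "\<exists>y0. hessian_vanishes_at \<phi> y0"
      then show thesis using case_i that[of "\<lambda>n. real (Suc n)" "\<lambda>_. _"] by blast
    next
      assume "\<exists>y. hessian_vanishes_along \<phi> y"
      then show thesis using case_ii that by blast
    qed
  qed
  note f = L2_normalize_tangent_exp[OF ctx]
  have opt: "opt_const \<phi> = ereal ?K"
  proof (rule antisym)
    show "opt_const \<phi> \<le> ereal ?K"
      unfolding opt_const_def
    proof (rule SUP_least)
      fix f assume "f \<in> {f. nonzero_L2 f}"
      then have L2: "in_L2 f" by (simp add: nonzero_L2_def)
      obtain c where c: "conv_norm \<phi> f = ereal c" "0 \<le> c" using conv_norm_le(3)[OF ctx L2] by blast
      have "c \<le> sqrt (pi / 2) * (L2_norm f)\<^sup>2" using conv_norm_le(1)[OF ctx L2] c by simp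
      then have "sqrt c \<le> sqrt (sqrt (pi / 2) * (L2_norm f)\<^sup>2)" by simp
      also have "\<dots> = ?K * L2_norm f"
        using L2_norm_nonneg[of f] by (simp only: real_sqrt_mult sqrtK) simp
      finally have le: "sqrt c \<le> ?K * L2_norm f" .
      show "ereal_sqrt (conv_norm \<phi> f) / ereal (L2_norm f) \<le> ereal ?K"
      \<comment> \<open>If the norm is 0, then \<open>c = 0\<close> and the quotient is
        \<open>0 / 0\<close>, which is 0 in \<open>ereal\<close>.\<close>
      proof (cases "L2_norm f = 0")
        case True
        then show ?thesis using le c by (simp add: ereal_sqrt_def)
      next
        case False
        then have "0 < L2_norm f" using L2_norm_nonneg[of f] by simp
        then show ?thesis using le c by (simp add: ereal_sqrt_def divide_le_eq)
      qed
    qed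
    have "(\<lambda>n. ereal_sqrt (conv_norm \<phi> (L2_normalize (tangent_exp \<phi> (a n) (z n))))) \<longlonglongrightarrow> ereal ?K"
    proof -
      define c where "c n = real_of_ereal (conv_norm \<phi> (L2_normalize (tangent_exp \<phi> (a n) (z n))))" for n
      have c: "conv_norm \<phi> (L2_normalize (tangent_exp \<phi> (a n) (z n))) = ereal (c n)" for n
        using conv_norm_le(3)[OF ctx f(1)[OF a], of n "z n"] unfolding c_def by force
      have "c \<longlonglongrightarrow> sqrt (pi / 2)" using lim by (simp add: c)
      then have "(\<lambda>n. sqrt (c n)) \<longlonglongrightarrow> ?K" unfolding sqrtK[symmetric] by (rule tendsto_real_sqrt)
      then show ?thesis by (simp add: c ereal_sqrt_def)
    qed
    then show "ereal ?K \<le> opt_const \<phi>"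
    proof (rule LIMSEQ_le_const2, intro exI allI impI)
      fix n
      let ?f = "L2_normalize (tangent_exp \<phi> (a n) (z n))"
      have "nonzero_L2 ?f"
        unfolding nonzero_L2_def
      proof
        show "in_L2 ?f" by (rule f(1)[OF a])
        show "\<not> (AE x in lborel. ?f x = 0)"
        proof
          assume "AE x in lborel. ?f x = 0"
          then have "L2_norm ?f = L2_norm (\<lambda>_::real^2. 0)"
            using in_L2_measurable[OF f(1)[OF a]] by (intro L2_cong_AE) auto
          then show False using f(2)[OF a, of n "z n"] by (simp add: L2_norm_def)
        qed
      qed
      then have "ereal_sqrt (conv_norm \<phi> ?f) / ereal (L2_norm ?f) \<le> opt_const \<phi>"
        unfolding opt_const_def by (intro SUP_upper) simp
      then show "ereal_sqrt (conv_norm \<phi> ?f) \<le> opt_const \<phi>"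
        by (simp add: f(2)[OF a] flip: one_ereal_def)
    qed
  qed
  have opt2: "(opt_const \<phi>)\<^sup>2 = ereal (sqrt (pi / 2))"
    by (simp add: opt K2)
  have extremizing: "extremizing_seq \<phi> (\<lambda>n. L2_normalize (tangent_exp \<phi> (b n) (y n)))"
    if "\<And>n. 0 < b n"
      and "(\<lambda>n. conv_norm \<phi> (L2_normalize (tangent_exp \<phi> (b n) (y n)))) \<longlonglongrightarrow> ereal (sqrt (pi / 2))"
    for b y
    unfolding extremizing_seq_def opt2 using f[OF that(1)] that(2) by simp
  show ?thesis
  proof (intro conjI allI impI)
    show "conv_norm \<phi> f \<le> (opt_const \<phi>)\<^sup>2 * ereal ((L2_norm f)\<^sup>2)" if "in_L2 f" for f
      using conv_norm_le(1)[OF ctx that] by (simp add: opt2)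
    show "opt_const \<phi> = ereal ?K" by (rule opt)
    show "extremizing_seq \<phi> (\<lambda>n. L2_normalize (tangent_exp \<phi> (real (Suc n)) y0))"
      if "hessian_vanishes_at \<phi> y0" for y0
      by (rule extremizing[OF case_i[OF that]])
    show "\<exists>a. (\<forall>n. a n > 0) \<and> extremizing_seq \<phi> (\<lambda>n. L2_normalize (tangent_exp \<phi> (a n) (y n)))"
      if "hessian_vanishes_along \<phi> y" for y
    proof -
      from case_ii[OF that] obtain b where b: "\<forall>n. 0 < b n"
        "(\<lambda>n. conv_norm \<phi> (L2_normalize (tangent_exp \<phi> (b n) (y n)))) \<longlonglongrightarrow> ereal (sqrt (pi / 2))"
        by (elim exE conjE)
      then show ?thesis using extremizing[of b y] by (intro exI[of _ b] conjI) simp_all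
    qed
    show "\<not> (\<exists>f. extremizer \<phi> f)"
    proof
      assume "\<exists>f. extremizer \<phi> f"
      then obtain f where f: "nonzero_L2 f" "conv_norm \<phi> f = (opt_const \<phi>)\<^sup>2 * ereal ((L2_norm f)\<^sup>2)"
        unfolding extremizer_def by (elim exE conjE)
      then have "in_L2 f" by (simp add: nonzero_L2_def)
      from conv_norm_le(2)[OF ctx this f(1)] f(2) show False by (simp add: opt2)
    qed
  qed
qed

end
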